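(* Let $\mathcal H^2(\beta)$ be spherically balanced with the slice representation $[\mu,\mathcal H^2(\gamma)]$, where $\mu$ is a (finite positive) Reinhardt Borel measure supported on $\partial\mathbb B_d$ and $\mathcal H^2(\gamma)$ is a Hilbert space of formal power series in one variable. Suppose that $\mathscr M_z$ on $\mathcal H^2(\beta)$ is bounded. Then $\mathscr M_z$ on $\mathcal H^2(\beta)$ is weakly $\mathcal U(d)$-homogeneous if and only if $\mathscr M_z$ on $\mathcal H^2(\beta)$ is similar to $\mathscr M_z$ on $\mathcal H^2(\tilde\beta)$ with slice representation $[\sigma,\mathcal H^2(\gamma)]$, where $\sigma$ is the normalized surface area measure on $\partial\mathbb B_d$.
   Context: $\mathbb N$ is the set of non-negative integers, $\mathbb B_d$ the open unit ball of $\mathbb C^d$. For a multisequence $\beta=\{\beta_\alpha:\alpha\in\mathbb N^d\}$ of positive reals, $\mathcal H^2(\beta)$ is the Hilbert space of formal power series $f=\sum_{\alpha\in\mathbb N^d}a_\alpha z^\alpha$, $a_\alpha\in\mathbb C$, in $z=(z_1,\ldots,z_d)$ with $\|f\|^2=\sum_\alpha|a_\alpha|^2\beta_\alpha^2<\infty$ (and the corresponding inner product). $\mathscr M_z=(\mathscr M_{z_1},\ldots,\mathscr M_{z_d})$ with $\mathscr M_{z_j}f=z_jf$. When $\mathscr M_z$ is bounded on $\mathcal H^2(\beta)$, $\mathcal H^2(\beta)$ is called spherically balanced if $$\sum_{k=1}^d\frac{\beta^2_{\alpha+\varepsilon_i+\varepsilon_k}}{\beta^2_{\alpha+\varepsilon_i}}=\sum_{k=1}^d\frac{\beta^2_{\alpha+\varepsilon_j+\varepsilon_k}}{\beta^2_{\alpha+\varepsilon_j}}\quad\text{for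 all }\alpha\in\mathbb N^d,\ i,j=1,\ldots,d,$$ where $\varepsilon_j$ is the $d$-tuple with $1$ in the $j$-th place and zeros elsewhere. A measure on $\partial\mathbb B_d$ is Reinhardt if it is invariant under $z\mapsto(t_1z_1,\ldots,t_dz_d)$, $t\in\mathbb T^d$. For a sequence $\gamma=(\gamma_n)_{n\in\mathbb N}$ of positive reals, $\mathcal H^2(\gamma)$ is the Hilbert space of formal power series $\sum_n a_nt^n$ in one variable with norm squared $\sum_n|a_n|^2\gamma_n^2$. $\mathcal H^2(\beta)$ has slice representation $[\mu,\mathcal H^2(\gamma)]$, with $\mu$ a finite positive Reinhardt Borel measure supported on $\partial\mathbb B_d$, if $\|f\|^2_{\mathcal H^2(\beta)}=\int_{\partial\mathbb B_d}\|f_z\|^2_{\mathcal H^2(\gamma)}\,d\mu(z)$ for all $f\in\mathcal H^2(\beta)$, where $f_z(t)=f(tz)$ is the slice of $f$ at $z$; in particular $\beta_\alpha=\gamma_{|\alpha|}\|z^\alpha\|_{L^2(\partial\mathbb B_d,\mu)}$ for all $\alpha\in\mathbb N^d$, with $|\alpha|=\sum_j\alpha_j$. Thus the space $\mathcal H^2(\tilde\beta)$ with slice representation $[\sigma,\mathcal H^2(\gamma)]$ has $\tilde\beta_\alpha=\gamma_{|\alpha|}\|z^\alpha\|_{L^2(\partial\mathbb B_d,\sigma)}$. $\mathcal U(d)$ is the group of $d\times d$ complex unitary matrices; for $u=(u_{jk})\in\mathcal U(d)$ and a $d$-tuple $T$ of operators, $(u\cdot T)_j=\sum_{k=1}^d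 u_{jk}T_k$. A commuting $d$-tuple $T$ of bounded operators on a complex separable Hilbert space $\mathcal H$ is weakly $\mathcal U(d)$-homogeneous if for every $u\in\mathcal U(d)$ there is a bounded invertible operator $\Gamma(u)$ on $\mathcal H$ with $\Gamma(u)T_j=(u\cdot T)_j\Gamma(u)$ for all $j$. Tuples $T$ on $\mathcal H$ and $T'$ on $\mathcal H'$ are similar if there is a bounded invertible $S:\mathcal H\to\mathcal H'$ with $ST_j=T'_jS$ for all $j$. *)

theory Defs
  imports "HOL-Analysis.Analysis"
begin

text \<open>
  A formal power series is represented by its family of coefficients, indexed by
  \<open>'d \<Rightarrow> nat\<close> (the multi-indices; the dimension is \<open>CARD('d)\<close>) or by \<open>nat\<close> (one variable).
  The space \<open>H\<^sup>2\<close> of a weight depends on the weight, hence it is a carrier set with a norm, and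
  an operator on it is a function on all coefficient families, of which only the
  restriction to the carrier matters.
\<close>

definition H2 :: "('i \<Rightarrow> real) \<Rightarrow> ('i \<Rightarrow> complex) set" where
  "H2 w = {f. (\<lambda>i. (cmod (f i))\<^sup>2 * (w i)\<^sup>2) summable_on UNIV}"

definition H2_norm :: "('i \<Rightarrow> real) \<Rightarrow> ('i \<Rightarrow> complex) \<Rightarrow> real" where
  "H2_norm w f = sqrt (\<Sum>\<^sub>\<infinity>i. (cmod (f i))\<^sup>2 * (w i)\<^sup>2)"

definition bounded_operator ::
  "('i \<Rightarrow> real) \<Rightarrow> ('k \<Rightarrow> real) \<Rightarrow> (('i \<Rightarrow> complex) \<Rightarrow> ('k \<Rightarrow> complex)) \<Rightarrow> bool" where
  "bounded_operator w v S \<longleftrightarrow>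
     (\<forall>f\<in>H2 w. S f \<in> H2 v) \<and>
     (\<forall>f\<in>H2 w. \<forall>g\<in>H2 w. S (\<lambda>i. f i + g i) = (\<lambda>k. S f k + S g k)) \<and>
     (\<forall>c. \<forall>f\<in>H2 w. S (\<lambda>i. c * f i) = (\<lambda>k. c * S f k)) \<and>
     (\<exists>C. \<forall>f\<in>H2 w. H2_norm v (S f) \<le> C * H2_norm w f)"

definition bounded_invertible_operator ::
  "('i \<Rightarrow> real) \<Rightarrow> ('k \<Rightarrow> real) \<Rightarrow> (('i \<Rightarrow> complex) \<Rightarrow> ('k \<Rightarrow> complex)) \<Rightarrow> bool" where
  "bounded_invertible_operator w v S \<longleftrightarrow>
     bounded_operator w v S \<and>
     (\<exists>R. bounded_operator v w R \<and> (\<forall>f\<in>H2 w. R (S f) = f) \<and> (\<forall>g\<in>H2 v. S (R g) = g))"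

text \<open>Tuples of operators are families indexed by \<open>'d\<close>.\<close>

definition bounded_tuple ::
  "('i \<Rightarrow> real) \<Rightarrow> ('d \<Rightarrow> ('i \<Rightarrow> complex) \<Rightarrow> ('i \<Rightarrow> complex)) \<Rightarrow> bool" where
  "bounded_tuple w T \<longleftrightarrow> (\<forall>j. bounded_operator w w (T j))"

definition commuting_tuple ::
  "('i \<Rightarrow> real) \<Rightarrow> ('d \<Rightarrow> ('i \<Rightarrow> complex) \<Rightarrow> ('i \<Rightarrow> complex)) \<Rightarrow> bool" where
  "commuting_tuple w T \<longleftrightarrow> (\<forall>j k. \<forall>f\<in>H2 w. T j (T k f) = T k (T j f))"

definition unitary_matrix :: "complex^'d^'d \<Rightarrow> bool" where
  "unitary_matrix u \<longleftrightarrow>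
     u ** (\<chi> i j. cnj (u $ j $ i)) = mat 1 \<and> (\<chi> i j. cnj (u $ j $ i)) ** u = mat 1"

definition unitary_action ::
  "complex^'d^'d \<Rightarrow> ('d \<Rightarrow> ('i \<Rightarrow> complex) \<Rightarrow> ('i \<Rightarrow> complex)) \<Rightarrow>
     'd \<Rightarrow> ('i \<Rightarrow> complex) \<Rightarrow> ('i \<Rightarrow> complex)" where
  "unitary_action u T j f = (\<lambda>i. \<Sum>k\<in>UNIV. u $ j $ k * T k f i)"

definition weakly_homogeneous ::
  "('i \<Rightarrow> real) \<Rightarrow> ('d::finite \<Rightarrow> ('i \<Rightarrow> complex) \<Rightarrow> ('i \<Rightarrow> complex)) \<Rightarrow> bool" where
  "weakly_homogeneous w T \<longleftrightarrow>
     bounded_tuple w T \<and> commuting_tuple w T \<and>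
     (\<forall>u :: complex^'d^'d. unitary_matrix u \<longrightarrow>
        (\<exists>\<Gamma>. bounded_invertible_operator w w \<Gamma> \<and>
             (\<forall>j. \<forall>f\<in>H2 w. \<Gamma> (T j f) = unitary_action u T j (\<Gamma> f))))"

definition similar_tuples ::
  "('i \<Rightarrow> real) \<Rightarrow> ('d \<Rightarrow> ('i \<Rightarrow> complex) \<Rightarrow> ('i \<Rightarrow> complex)) \<Rightarrow>
   ('k \<Rightarrow> real) \<Rightarrow> ('d \<Rightarrow> ('k \<Rightarrow> complex) \<Rightarrow> ('k \<Rightarrow> complex)) \<Rightarrow> bool" where
  "similar_tuples w T v T' \<longleftrightarrow>
     bounded_tuple w T \<and> bounded_tuple v T' \<and>
     (\<exists>S. bounded_invertible_operator w v S \<and> (\<forall>j. \<forall>f\<in>H2 w. S (T j f) = T' j (S f)))"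

text \<open>The coefficient of \<open>z\<^sub>j f\<close> at \<open>\<alpha>\<close> is that of \<open>f\<close> at \<open>\<alpha> - \<epsilon>\<^sub>j\<close>, or 0 if \<open>\<alpha>\<^sub>j = 0\<close>.\<close>

definition Mz :: "'d \<Rightarrow> (('d \<Rightarrow> nat) \<Rightarrow> complex) \<Rightarrow> (('d \<Rightarrow> nat) \<Rightarrow> complex)" where
  "Mz j f = (\<lambda>\<alpha>. if \<alpha> j = 0 then 0 else f (\<alpha>(j := \<alpha> j - 1)))"

text \<open>\<open>add_eps j \<alpha>\<close> is \<open>\<alpha> + \<epsilon>\<^sub>j\<close>.\<close>

definition add_eps :: "'d \<Rightarrow> ('d \<Rightarrow> nat) \<Rightarrow> ('d \<Rightarrow> nat)" where
  "add_eps j \<alpha> = \<alpha>(j := \<alpha> j + 1)"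

definition spherically_balanced :: "(('d::finite \<Rightarrow> nat) \<Rightarrow> real) \<Rightarrow> bool" where
  "spherically_balanced \<beta> \<longleftrightarrow>
     bounded_tuple \<beta> Mz \<and>
     (\<forall>\<alpha> i j.
        (\<Sum>k\<in>UNIV. (\<beta> (add_eps k (add_eps i \<alpha>)))\<^sup>2 / (\<beta> (add_eps i \<alpha>))\<^sup>2) =
        (\<Sum>k\<in>UNIV. (\<beta> (add_eps k (add_eps j \<alpha>)))\<^sup>2 / (\<beta> (add_eps j \<alpha>))\<^sup>2))"

text \<open>The one-variable series \<open>f\<^sub>z(t) = f(tz)\<close>.\<close>

definition slice :: "(('d::finite \<Rightarrow> nat) \<Rightarrow> complex) \<Rightarrow> complex^'d \<Rightarrow> (nat \<Rightarrow> complex)" where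
  "slice f z = (\<lambda>n. \<Sum>\<alpha> | (\<Sum>j\<in>UNIV. \<alpha> j) = n. f \<alpha> * (\<Prod>j\<in>UNIV. (z $ j) ^ \<alpha> j))"

definition reinhardt_sphere_measure :: "(complex^'d) measure \<Rightarrow> bool" where
  "reinhardt_sphere_measure \<mu> \<longleftrightarrow>
     sets \<mu> = sets borel \<and> finite_measure \<mu> \<and> emeasure \<mu> (- sphere 0 1) = 0 \<and>
     (\<forall>t :: complex^'d. (\<forall>j. cmod (t $ j) = 1) \<longrightarrow> distr \<mu> borel (\<lambda>z. \<chi> j. t $ j * z $ j) = \<mu>)"

text \<open>
  \<^const>\<open>H2_norm\<close> is a junk value outside the space, so that \<open>f\<^sub>z \<in> H\<^sup>2(\<gamma>)\<close> for almost all \<open>z\<close>,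
  implicit in the finiteness of the integral of \<open>\<parallel>f\<^sub>z\<parallel>\<^sup>2\<close>, has to be stated explicitly.
\<close>

definition has_slice_representation ::
  "(('d::finite \<Rightarrow> nat) \<Rightarrow> real) \<Rightarrow> (complex^'d) measure \<Rightarrow> (nat \<Rightarrow> real) \<Rightarrow> bool" where
  "has_slice_representation \<beta> \<mu> \<gamma> \<longleftrightarrow>
     reinhardt_sphere_measure \<mu> \<and>
     (\<forall>f\<in>H2 \<beta>.
        (AE z in \<mu>. slice f z \<in> H2 \<gamma>) \<and>
        (\<integral>\<^sup>+ z. ennreal ((H2_norm \<gamma> (slice f z))\<^sup>2) \<partial>\<mu>) = ennreal ((H2_norm \<beta> f)\<^sup>2))"

text \<open>
  The normalized surface area of a Borel subset \<open>A\<close> of the unit sphere is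
  the proportion of the volume of the unit ball taken up by the cone
  \<open>{r \<zeta> | \<zeta> \<in> A, 0 < r < 1}\<close> (integration in polar coordinates).
\<close>

definition normalized_surface_measure :: "(complex^'d) measure" where
  "normalized_surface_measure =
     distr (uniform_measure lborel (ball 0 1)) borel (\<lambda>z. z /\<^sub>R norm z)"

end

theory Submission
  imports Defs
begin

text \<open>
In both spaces the weight factors as \<open>\<gamma>\<^sub>n\<close>, with \<open>n = |\<alpha>|\<close>, times the \<open>L\<^sup>2\<close> norm of \<open>z\<^sup>\<alpha>\<close> over the sphere, with respect to
\<open>\<mu>\<close> or to the surface measure \<open>\<sigma>\<close> (lemma \<open>has_slice_representation_iff\<close>). This rests on the
orthogonality of the monomials, which is where the Reinhardt property enters. The theorem says that weak homogeneity
holds exactly if these two norms of \<open>z\<^sup>\<alpha>\<close> are comparable, uniformly in \<open>\<alpha>\<close>.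

If the two tuples are similar, then weak homogeneity can be carried over from the space over \<open>\<sigma>\<close>, where \<open>f(z) \<mapsto> f(uz)\<close> is
a unitary operator with the required intertwining property because \<open>\<sigma>\<close> is unitarily invariant
(\<open>surface_space_weakly_homogeneous\<close>, \<open>weakly_homogeneous_similar\<close>).

Conversely, let \<open>\<Gamma>\<close> be an intertwiner for \<open>u\<close> and \<open>h = \<Gamma> 1\<close>. Then \<open>\<Gamma> p = p(uz) h\<close> for polynomials
\<open>p\<close>, and \<open>h(0) \<noteq> 0\<close> because \<open>\<Gamma>\<close> is onto. Comparing the lowest components for \<open>p\<close> homogeneous shows that the
\<open>L\<^sup>2(\<mu>)\<close> norm of \<open>p(uz)\<close> is at most a constant times that of \<open>p\<close>, the constant depending only on \<open>u\<close>
(\<open>composition_bound\<close>). By Baire's theorem and compactness of the unitary group, one constant serves all \<open>u\<close>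
(\<open>uniform_composition_bound\<close>). Averaging \<open>|p(uz)|\<^sup>2\<close> over \<open>u\<close> turns the integral against \<open>\<mu>\<close> into the total mass of
\<open>\<mu>\<close> times the integral against \<open>\<sigma>\<close>, so the norms of \<open>p = z\<^sup>\<alpha>\<close> are comparable
(\<open>moments_comparable\<close>) and the identity map is a similarity.

The average does not use Haar measure. Finite means of unitary translates of a continuous function on
the sphere come uniformly close to a constant, which by invariance of \<open>\<sigma>\<close> is its mean
(\<open>averages_nearly_constant\<close>, \<open>surface_mean_between\<close>). The invariance of \<open>\<sigma>\<close> is derived from
the uniqueness of translation invariant measures (\<open>translation_invariant_eq_lborel\<close>).
\<close>

section \<open>Homogeneous components and linear substitutions\<close>

definition mdeg :: "('d::finite \<Rightarrow> nat) \<Rightarrow> nat" where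
  "mdeg \<alpha> = (\<Sum>j\<in>UNIV. \<alpha> j)"

definition zpow :: "complex^'d \<Rightarrow> ('d::finite \<Rightarrow> nat) \<Rightarrow> complex" where
  "zpow z \<alpha> = (\<Prod>j\<in>UNIV. (z $ j) ^ \<alpha> j)"

definition single :: "'i \<Rightarrow> 'i \<Rightarrow> complex" where
  "single \<alpha> = (\<lambda>\<kappa>. if \<kappa> = \<alpha> then 1 else 0)"

lemma finite_mdeg [simp]: "finite {\<alpha> :: 'd::finite \<Rightarrow> nat. mdeg \<alpha> = n}"
proof (rule finite_subset)
  show "finite {f :: 'd \<Rightarrow> nat. \<forall>x. (x \<in> UNIV \<longrightarrow> f x \<in> {..n}) \<and> (x \<notin> UNIV \<longrightarrow> f x = 0)}"
    by (rule finite_set_of_finite_funs) auto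
  show "{\<alpha>. mdeg \<alpha> = n} \<subseteq> {f :: 'd \<Rightarrow> nat. \<forall>x. (x \<in> UNIV \<longrightarrow> f x \<in> {..n}) \<and> (x \<notin> UNIV \<longrightarrow> f x = 0)}"
    by (auto simp: mdeg_def intro: member_le_sum)
qed

lemma slice_eq: "slice f z n = (\<Sum>\<alpha> | mdeg \<alpha> = n. f \<alpha> * zpow z \<alpha>)"
  by (simp add: slice_def mdeg_def zpow_def)

lemma mdeg_add_eps [simp]: "mdeg (add_eps j \<alpha>) = Suc (mdeg \<alpha>)"
proof -
  have "mdeg (add_eps j \<alpha>) = (\<Sum>k\<in>UNIV. \<alpha> k + (if k = j then 1 else 0))"
    unfolding mdeg_def add_eps_def by (rule sum.cong) auto
  then show ?thesis by (simp add: sum.distrib mdeg_def)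
qed

lemma zpow_add_eps: "zpow z (add_eps j \<alpha>) = z $ j * zpow z \<alpha>"
proof -
  have "zpow z (add_eps j \<alpha>) = (\<Prod>k\<in>UNIV. (if k = j then z $ k else 1) * (z $ k) ^ \<alpha> k)"
    unfolding zpow_def add_eps_def by (rule prod.cong) auto
  then show ?thesis by (simp add: prod.distrib zpow_def)
qed

lemma add_eps_sub [simp]: "0 < \<alpha> j \<Longrightarrow> add_eps j (\<alpha>(j := \<alpha> j - Suc 0)) = \<alpha>"
  by (auto simp: add_eps_def)

lemma sub_add_eps [simp]: "(add_eps j \<alpha>)(j := add_eps j \<alpha> j - Suc 0) = \<alpha>"
  by (auto simp: add_eps_def)

lemma mdeg_zero_iff: "mdeg \<alpha> = 0 \<longleftrightarrow> \<alpha> = (\<lambda>_. 0)"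
  by (auto simp: mdeg_def)

lemma zpow_zero [simp]: "zpow z (\<lambda>_. 0) = 1"
  by (simp add: zpow_def)

lemma mdeg_Suc_cases:
  assumes "mdeg \<alpha> = Suc n"
  obtains j \<alpha>' where "\<alpha> = add_eps j \<alpha>'" "mdeg \<alpha>' = n"
proof -
  have "\<alpha> \<noteq> (\<lambda>_. 0)" using assms mdeg_zero_iff[of \<alpha>] by auto
  then obtain j where j: "\<alpha> j \<noteq> 0" by auto
  then have "\<alpha> = add_eps j (\<alpha>(j := \<alpha> j - 1))" by simp
  moreover from this assms have "mdeg (\<alpha>(j := \<alpha> j - 1)) = n"
    using mdeg_add_eps[of j "\<alpha>(j := \<alpha> j - 1)"] by simp
  ultimately show ?thesis using that by blast
qed

lemma slice_add: "slice (\<lambda>i. f i + g i) z n = slice f z n + slice g z n"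
  by (simp add: slice_eq distrib_right sum.distrib)

lemma slice_mult: "slice (\<lambda>i. c * f i) z n = c * slice f z n"
  by (simp add: slice_eq sum_distrib_left mult.assoc)

lemma slice_sum: "slice (\<lambda>i. \<Sum>k\<in>K. c k * f k i) z n = (\<Sum>k\<in>K. c k * slice (f k) z n)"
  unfolding slice_eq
  by (subst sum_distrib_left, subst sum.swap) (simp add: sum_distrib_right mult.assoc)

lemma slice_Mz_0: "slice (Mz j f) z 0 = 0"
  by (auto simp: slice_eq Mz_def mdeg_zero_iff)

lemma slice_Mz_Suc: "slice (Mz j f) z (Suc n) = z $ j * slice f z n"
proof -
  have "slice (Mz j f) z (Suc n) = (\<Sum>\<alpha> | mdeg \<alpha> = Suc n \<and> \<alpha> j \<noteq> 0. Mz j f \<alpha> * zpow z \<alpha>)"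
    unfolding slice_eq by (rule sum.mono_neutral_right) (auto simp: Mz_def intro: finite_subset[OF _ finite_mdeg])
  also have "\<dots> = (\<Sum>\<alpha> | mdeg \<alpha> = n. f \<alpha> * zpow z (add_eps j \<alpha>))"
  proof (rule sum.reindex_bij_witness[where j = "\<lambda>\<alpha>. \<alpha>(j := \<alpha> j - 1)" and i = "add_eps j"])
    fix \<alpha> assume a: "\<alpha> \<in> {\<alpha>. mdeg \<alpha> = Suc n \<and> \<alpha> j \<noteq> 0}"
    then show "add_eps j (\<alpha>(j := \<alpha> j - 1)) = \<alpha>" by simp
    from a show "\<alpha>(j := \<alpha> j - 1) \<in> {\<alpha>. mdeg \<alpha> = n}"
      using mdeg_add_eps[of j "\<alpha>(j := \<alpha> j - 1)"] by simp
    from a show "f (\<alpha>(j := \<alpha> j - 1)) * zpow z (add_eps j (\<alpha>(j := \<alpha> j - 1))) = Mz j f \<alpha> * zpow z \<alpha>"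
      by (simp add: Mz_def)
  next
    fix \<alpha> :: "'a \<Rightarrow> nat" assume "\<alpha> \<in> {\<alpha>. mdeg \<alpha> = n}"
    then show "(add_eps j \<alpha>)(j := add_eps j \<alpha> j - 1) = \<alpha>" "add_eps j \<alpha> \<in> {\<alpha>. mdeg \<alpha> = Suc n \<and> \<alpha> j \<noteq> 0}"
      by (simp, simp, simp add: add_eps_def)
  qed
  also have "\<dots> = z $ j * slice f z n"
    unfolding slice_eq sum_distrib_left by (rule sum.cong) (auto simp: zpow_add_eps)
  finally show ?thesis .
qed

lemma slice_unitary_action_0: "slice (unitary_action u Mz j f) z 0 = 0"
  by (simp add: unitary_action_def slice_sum slice_Mz_0)

lemma slice_unitary_action_Suc:
  "slice (unitary_action u Mz j f) z (Suc n) = (u *v z) $ j * slice f z n"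
  by (simp add: unitary_action_def slice_sum slice_Mz_Suc matrix_vector_mult_def sum_distrib_right mult.assoc)

lemma slice_single: "slice (single \<alpha>) z n = (if n = mdeg \<alpha> then zpow z \<alpha> else 0)"
proof (cases "n = mdeg \<alpha>")
  case True
  have "slice (single \<alpha>) z n = (\<Sum>\<kappa> | mdeg \<kappa> = n. if \<kappa> = \<alpha> then zpow z \<kappa> else 0)"
    unfolding slice_eq by (rule sum.cong) (auto simp: single_def)
  then show ?thesis using True by (simp add: sum.delta)
next
  case False
  then show ?thesis by (auto simp: slice_eq single_def intro!: sum.neutral)
qed

lemma Mz_single: "Mz j (single \<alpha>) = single (add_eps j \<alpha>)"
proof
  fix \<kappa>
  show "Mz j (single \<alpha>) \<kappa> = single (add_eps j \<alpha>) \<kappa>"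
    using add_eps_sub[of \<kappa> j] sub_add_eps[of j \<alpha>]
    by (auto simp: Mz_def single_def add_eps_def split: if_splits)
qed

text \<open>A monomial \<open>z\<^sub>j z\<^sup>\<alpha>\<close> becomes \<open>(uz)\<^sub>j (uz)\<^sup>\<alpha>\<close> after substituting \<open>uz\<close>, and multiplication by the linear form
\<open>(uz)\<^sub>j\<close> is the \<open>j\<close>-th entry of \<open>u \<cdot> M\<^sub>z\<close> on coefficients. Iterating over the
degree builds the coefficients without expanding a product of linear forms.\<close>

lemma ex_slice_single_matrix:
  fixes u :: "complex^'d^'d"
  shows "\<exists>g. \<forall>z n. slice g z n = slice (single \<alpha>) (u *v z) n"
proof (induction "mdeg \<alpha>" arbitrary: \<alpha>)
  case 0
  then have "\<alpha> = (\<lambda>_. 0)" using mdeg_zero_iff[of \<alpha>] by simp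
  then show ?case by (intro exI[of _ "single \<alpha>"]) (auto simp: slice_single)
next
  case (Suc n)
  then obtain j \<alpha>' where a: "\<alpha> = add_eps j \<alpha>'" "mdeg \<alpha>' = n" by (metis mdeg_Suc_cases)
  with Suc obtain g where g: "\<forall>z n. slice g z n = slice (single \<alpha>') (u *v z) n" by metis
  show ?case
  proof (intro exI allI)
    fix z n
    show "slice (unitary_action u Mz j g) z n = slice (single \<alpha>) (u *v z) n"
      by (cases n) (auto simp: slice_unitary_action_0 slice_unitary_action_Suc g slice_Mz_0 slice_Mz_Suc
            a(1) Mz_single[symmetric])
  qed
qed

lemma ex_slice_matrix:
  fixes u :: "complex^'d^'d"
  shows "\<exists>g. \<forall>z n. slice g z n = slice f (u *v z) n"
proof -
  obtain G where G: "\<And>\<alpha> z n. slice (G \<alpha>) z n = slice (single \<alpha>) (u *v z) n"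
    using ex_slice_single_matrix[where u = u] by metis
  define g where "g = (\<lambda>\<kappa>. \<Sum>\<alpha> | mdeg \<alpha> = mdeg \<kappa>. f \<alpha> * G \<alpha> \<kappa>)"
  have "slice g z n = slice f (u *v z) n" for z n
  proof -
    have "slice g z n = slice (\<lambda>\<kappa>. \<Sum>\<alpha> | mdeg \<alpha> = n. f \<alpha> * G \<alpha> \<kappa>) z n"
      unfolding slice_eq by (rule sum.cong) (auto simp: g_def)
    also have "\<dots> = (\<Sum>\<alpha> | mdeg \<alpha> = n. f \<alpha> * slice (single \<alpha>) (u *v z) n)"
      by (simp add: slice_sum G)
    also have "\<dots> = slice f (u *v z) n"
      unfolding slice_eq[of f] by (rule sum.cong) (auto simp: slice_single)
    finally show ?thesis .
  qed
  then show ?thesis by blast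
qed

lemma continuous_on_zpow [continuous_intros]:
  "continuous_on A h \<Longrightarrow> continuous_on A (\<lambda>x. zpow (h x) \<alpha>)"
  unfolding zpow_def by (intro continuous_intros)

lemma continuous_on_slice [continuous_intros]:
  "continuous_on A h \<Longrightarrow> continuous_on A (\<lambda>x. slice f (h x) n)"
  unfolding slice_eq by (intro continuous_intros)

lemma measurable_slice [measurable]: "(\<lambda>z. slice f z n) \<in> borel_measurable borel"
  by (intro borel_measurable_continuous_onI continuous_intros)

section \<open>Slice representations and moments of Reinhardt measures\<close>

definition moment :: "(complex^'d::finite) measure \<Rightarrow> ('d \<Rightarrow> nat) \<Rightarrow> real" where
  "moment \<mu> \<alpha> = (\<integral>z. (cmod (zpow z \<alpha>))\<^sup>2 \<partial>\<mu>)"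

text \<open>The squared norm with values in \<open>[0, \<infinity>]\<close>: belonging to the space is finiteness of this number, so norm
identities and membership can be proved together.\<close>

definition H2_sq :: "('i \<Rightarrow> real) \<Rightarrow> ('i \<Rightarrow> complex) \<Rightarrow> ennreal" where
  "H2_sq w f = (\<integral>\<^sup>+ i. ennreal ((cmod (f i))\<^sup>2 * (w i)\<^sup>2) \<partial>count_space UNIV)"

lemma H2_iff_abs_summable: "f \<in> H2 w \<longleftrightarrow> Infinite_Set_Sum.abs_summable_on (\<lambda>i. (cmod (f i))\<^sup>2 * (w i)\<^sup>2) UNIV"
  unfolding H2_def mem_Collect_eq by (rule trans[OF summable_on_iff_abs_summable_on_real abs_summable_equivalent])

lemma H2_iff: "f \<in> H2 w \<longleftrightarrow> H2_sq w f < \<infinity>"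
  unfolding H2_iff_abs_summable Infinite_Set_Sum.abs_summable_on_def integrable_iff_bounded H2_sq_def by simp

lemma H2_norm_nonneg [simp]: "0 \<le> H2_norm w f"
  unfolding H2_norm_def by (auto intro!: infsum_nonneg)

lemma H2_norm_sq: "(H2_norm w f)\<^sup>2 = (\<Sum>\<^sub>\<infinity>i. (cmod (f i))\<^sup>2 * (w i)\<^sup>2)"
  unfolding H2_norm_def by (intro real_sqrt_pow2 infsum_nonneg) auto

lemma H2_sq_eq:
  assumes "f \<in> H2 w"
  shows "H2_sq w f = ennreal ((H2_norm w f)\<^sup>2)"
proof -
  note a = assms[unfolded H2_iff_abs_summable]
  have "H2_sq w f = ennreal (\<Sum>\<^sub>ai. (cmod (f i))\<^sup>2 * (w i)\<^sup>2)"
    unfolding H2_sq_def by (rule nn_integral_conv_infsetsum[OF a]) auto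
  also have "(\<Sum>\<^sub>ai. (cmod (f i))\<^sup>2 * (w i)\<^sup>2) = (H2_norm w f)\<^sup>2"
    unfolding H2_norm_sq by (rule infsetsum_infsum[OF a])
  finally show ?thesis .
qed

lemma H2_sq_mono_bound:
  assumes "H2_sq v g \<le> ennreal (C\<^sup>2) * H2_sq w f" "f \<in> H2 w" "0 \<le> C"
  shows "g \<in> H2 v" "H2_norm v g \<le> C * H2_norm w f"
proof -
  have le: "H2_sq v g \<le> ennreal ((C * H2_norm w f)\<^sup>2)"
    using assms by (simp add: H2_sq_eq power_mult_distrib ennreal_mult)
  then show g: "g \<in> H2 v" by (auto simp: H2_iff intro: order.strict_trans1)
  have "ennreal ((H2_norm v g)\<^sup>2) \<le> ennreal ((C * H2_norm w f)\<^sup>2)"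
    using le by (simp only: H2_sq_eq[OF g])
  then have "(H2_norm v g)\<^sup>2 \<le> (C * H2_norm w f)\<^sup>2"
    by (rule ennreal_le_iff[THEN iffD1, rotated]) (rule zero_le_power2)
  then show "H2_norm v g \<le> C * H2_norm w f"
    by (rule power2_le_imp_le) (intro mult_nonneg_nonneg assms H2_norm_nonneg)
qed

lemma reinhardt_facts:
  fixes \<mu> :: "(complex^'d) measure"
  assumes "reinhardt_sphere_measure \<mu>"
  shows "finite_measure \<mu>" "sets \<mu> = sets borel" "space \<mu> = UNIV" "AE z in \<mu>. norm z = 1"
proof -
  show "finite_measure \<mu>" and s: "sets \<mu> = sets borel" using assms by (auto simp: reinhardt_sphere_measure_def)
  show "space \<mu> = UNIV" using sets_eq_imp_space_eq[OF s] by simp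
  show "AE z in \<mu>. norm z = 1"
  proof (rule AE_I[where N = "- sphere 0 1"])
    show "- sphere 0 1 \<in> sets \<mu>" unfolding s by auto
    show "emeasure \<mu> (- sphere 0 1) = 0" using assms by (auto simp: reinhardt_sphere_measure_def)
  qed auto
qed

lemma integrable_continuous_sphere:
  fixes \<mu> :: "(complex^'d) measure" and F :: "complex^'d \<Rightarrow> 'b::{banach, second_countable_topology}"
  assumes \<mu>: "reinhardt_sphere_measure \<mu>" and F: "continuous_on UNIV F"
  shows "integrable \<mu> F"
proof -
  interpret finite_measure \<mu> by (rule reinhardt_facts[OF \<mu>])
  have "compact (F ` sphere 0 1)"
    by (intro compact_continuous_image continuous_on_subset[OF F]) auto
  then obtain B where B: "\<And>z. norm z = 1 \<Longrightarrow> norm (F z) \<le> B"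
    by (fastforce dest!: compact_imp_bounded simp: bounded_iff)
  show ?thesis
  proof (rule integrable_const_bound[where B = B])
    show "AE z in \<mu>. norm (F z) \<le> B" using reinhardt_facts(4)[OF \<mu>] by eventually_elim (rule B)
    show "F \<in> borel_measurable \<mu>"
      using borel_measurable_continuous_onI[OF F] measurable_cong_sets[OF reinhardt_facts(2)[OF \<mu>] refl] by blast
  qed
qed

lemma zpow_mult: "zpow (\<chi> j. t $ j * z $ j) \<alpha> = zpow t \<alpha> * zpow z \<alpha>"
  by (simp add: zpow_def power_mult_distrib prod.distrib)

text \<open>Rotating the single coordinate \<open>j\<close> where the exponents differ by \<open>c\<close> multiplies the integral by
\<open>c\<^sup>a\<close> with \<open>a = \<alpha>\<^sub>j - \<kappa>\<^sub>j \<noteq> 0\<close>; choosing \<open>c\<close> with \<open>c\<^sup>a = -1\<close>, the integral equals its negative.\<close>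

lemma monomials_orthogonal:
  fixes \<mu> :: "(complex^'d) measure"
  assumes \<mu>: "reinhardt_sphere_measure \<mu>" and "\<alpha> \<noteq> \<kappa>"
  shows "(\<integral>z. zpow z \<alpha> * cnj (zpow z \<kappa>) \<partial>\<mu>) = 0" (is "?I = 0")
proof -
  obtain j where j: "\<alpha> j \<noteq> \<kappa> j" using assms(2) by auto
  obtain c where c: "cmod c = 1" "c ^ \<alpha> j * cnj (c ^ \<kappa> j) \<noteq> 1"
  proof -
    \<comment> \<open>The sign of the exponent difference is irrelevant: a root of \<open>-1\<close> of order \<open>|\<alpha>\<^sub>j - \<kappa>\<^sub>j|\<close> serves both cases.\<close>
    define k where "k = max (\<alpha> j) (\<kappa> j) - min (\<alpha> j) (\<kappa> j)"
    define c where "c = cis (pi / real k)"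
    have k: "k > 0" using j by (auto simp: k_def)
    have ck: "c ^ k = -1" using k by (simp add: c_def Complex.DeMoivre)
    have n: "cmod c = 1" by (simp add: c_def)
    have nn: "c ^ m * cnj (c ^ m) = 1" for m
      using n by (metis complex_norm_square norm_power of_real_1 power_one)
    have "c ^ \<alpha> j * cnj (c ^ \<kappa> j) = -1"
    proof (cases "\<alpha> j \<le> \<kappa> j")
      case True
      then have "\<kappa> j = k + \<alpha> j" by (simp add: k_def)
      then have "c ^ \<alpha> j * cnj (c ^ \<kappa> j) = (c ^ \<alpha> j * cnj (c ^ \<alpha> j)) * cnj (c ^ k)"
        by (simp add: power_add mult_ac)
      then show ?thesis by (simp only: nn ck) simp
    next
      case False
      then have "\<alpha> j = k + \<kappa> j" by (simp add: k_def)
      then have "c ^ \<alpha> j * cnj (c ^ \<kappa> j) = (c ^ \<kappa> j * cnj (c ^ \<kappa> j)) * c ^ k"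
        by (simp add: power_add mult_ac)
      then show ?thesis by (simp only: nn ck) simp
    qed
    then show ?thesis using that[of c] n by auto
  qed
  define t :: "complex^'d" where "t = (\<chi> k. if k = j then c else 1)"
  have zt: "zpow t \<beta> = c ^ \<beta> j" for \<beta>
  proof -
    have "zpow t \<beta> = (\<Prod>k\<in>UNIV. if k = j then c ^ \<beta> k else 1)"
      unfolding zpow_def t_def by (rule prod.cong) auto
    then show ?thesis by simp
  qed
  define T where "T = (\<lambda>z :: complex^'d. (\<chi> j. t $ j * z $ j))"
  have T: "T \<in> borel_measurable \<mu>"
    unfolding measurable_cong_sets[OF reinhardt_facts(2)[OF \<mu>] refl] T_def
    by (intro borel_measurable_continuous_onI continuous_intros)
  have "\<forall>k. cmod (t $ k) = 1" using c(1) by (simp add: t_def)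
  then have "distr \<mu> borel T = \<mu>"
    using \<mu> unfolding reinhardt_sphere_measure_def T_def by blast
  then have "?I = (\<integral>z. zpow z \<alpha> * cnj (zpow z \<kappa>) \<partial>distr \<mu> borel T)" by simp
  also have "\<dots> = (\<integral>z. zpow (T z) \<alpha> * cnj (zpow (T z) \<kappa>) \<partial>\<mu>)"
    by (rule integral_distr[OF T]) (intro borel_measurable_continuous_onI continuous_intros)
  also have "\<dots> = (\<integral>z. (c ^ \<alpha> j * cnj (c ^ \<kappa> j)) * (zpow z \<alpha> * cnj (zpow z \<kappa>)) \<partial>\<mu>)"
    unfolding T_def zpow_mult zt by (simp add: mult_ac)
  also have "\<dots> = (c ^ \<alpha> j * cnj (c ^ \<kappa> j)) * ?I" by simp
  finally have e: "?I = (c ^ \<alpha> j * cnj (c ^ \<kappa> j)) * ?I" .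
  have "(1 - c ^ \<alpha> j * cnj (c ^ \<kappa> j)) * ?I = 0"
    by (simp only: left_diff_distrib mult_1_left e[symmetric] diff_self)
  moreover have "1 - c ^ \<alpha> j * cnj (c ^ \<kappa> j) \<noteq> 0" using c(2) by (simp only: right_minus_eq)
  ultimately show ?thesis by (metis mult_eq_0_iff)
qed

lemma moment_nonneg [simp]: "0 \<le> moment \<mu> \<alpha>"
  by (simp add: moment_def)

lemma integral_slice_sq:
  fixes \<mu> :: "(complex^'d) measure"
  assumes \<mu>: "reinhardt_sphere_measure \<mu>"
  shows "(\<integral>z. (cmod (slice f z n))\<^sup>2 \<partial>\<mu>) = (\<Sum>\<alpha> | mdeg \<alpha> = n. (cmod (f \<alpha>))\<^sup>2 * moment \<mu> \<alpha>)"
proof -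
  let ?A = "{\<alpha> :: 'd \<Rightarrow> nat. mdeg \<alpha> = n}"
  let ?I = "\<lambda>\<alpha> \<kappa>. (\<integral>z. zpow z \<alpha> * cnj (zpow z \<kappa>) \<partial>\<mu>)"
  have int: "integrable \<mu> (\<lambda>z. c * (zpow z \<alpha> * cnj (zpow z \<kappa>)))" for \<alpha> \<kappa> c
    by (rule integrable_continuous_sphere[OF \<mu>]) (intro continuous_intros)
  have diag: "?I \<alpha> \<alpha> = of_real (moment \<mu> \<alpha>)" for \<alpha>
    unfolding moment_def integral_complex_of_real[symmetric] by (simp only: complex_norm_square)
  have "of_real (\<integral>z. (cmod (slice f z n))\<^sup>2 \<partial>\<mu>) = (\<integral>z. slice f z n * cnj (slice f z n) \<partial>\<mu>)"
    unfolding integral_complex_of_real[symmetric] by (simp only: complex_norm_square)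
  also have "\<dots> = (\<integral>z. (\<Sum>\<alpha>\<in>?A. \<Sum>\<kappa>\<in>?A. (f \<alpha> * cnj (f \<kappa>)) * (zpow z \<alpha> * cnj (zpow z \<kappa>))) \<partial>\<mu>)"
    unfolding slice_eq cnj_sum sum_product by (simp add: mult_ac)
  also have "\<dots> = (\<Sum>\<alpha>\<in>?A. \<Sum>\<kappa>\<in>?A. (f \<alpha> * cnj (f \<kappa>)) * ?I \<alpha> \<kappa>)"
    by (simp add: Bochner_Integration.integral_sum int Bochner_Integration.integrable_sum)
  also have "\<dots> = (\<Sum>\<alpha>\<in>?A. \<Sum>\<kappa>\<in>?A. if \<kappa> = \<alpha> then (f \<alpha> * cnj (f \<alpha>)) * ?I \<alpha> \<alpha> else 0)"
    by (intro sum.cong refl) (auto simp: monomials_orthogonal[OF \<mu>])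
  also have "\<dots> = (\<Sum>\<alpha>\<in>?A. (f \<alpha> * cnj (f \<alpha>)) * ?I \<alpha> \<alpha>)"
    by (intro sum.cong refl) simp
  also have "\<dots> = (\<Sum>\<alpha>\<in>?A. of_real ((cmod (f \<alpha>))\<^sup>2 * moment \<mu> \<alpha>))"
    unfolding diag by (simp only: complex_norm_square of_real_mult)
  also have "\<dots> = of_real (\<Sum>\<alpha>\<in>?A. (cmod (f \<alpha>))\<^sup>2 * moment \<mu> \<alpha>)" by simp
  finally show ?thesis by (simp only: of_real_eq_iff)
qed

lemma H2_sq_nat: "H2_sq \<gamma> a = (\<Sum>n. ennreal ((cmod (a n))\<^sup>2 * (\<gamma> n)\<^sup>2))"
  by (simp add: H2_sq_def nn_integral_count_space_nat)

lemma H2_sq_by_degree: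
  "H2_sq w f = (\<Sum>n. ennreal (\<Sum>\<alpha> | mdeg \<alpha> = n. (cmod (f \<alpha>))\<^sup>2 * (w \<alpha>)\<^sup>2))"
proof -
  let ?g = "\<lambda>\<alpha>. ennreal ((cmod (f \<alpha>))\<^sup>2 * (w \<alpha>)\<^sup>2)"
  have "H2_sq w f = (\<integral>\<^sup>+ \<alpha>. (\<Sum>n. ?g \<alpha> * indicator {\<alpha>. mdeg \<alpha> = n} \<alpha>) \<partial>count_space UNIV)"
    unfolding H2_sq_def
  proof (rule nn_integral_cong)
    fix \<alpha> :: "'a \<Rightarrow> nat"
    have "(\<lambda>n. ?g \<alpha> * indicator {\<alpha>. mdeg \<alpha> = n} \<alpha>) sums (\<Sum>n\<in>{mdeg \<alpha>}. ?g \<alpha> * indicator {\<alpha>. mdeg \<alpha> = n} \<alpha>)"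
      by (rule sums_finite) auto
    then show "?g \<alpha> = (\<Sum>n. ?g \<alpha> * indicator {\<alpha>. mdeg \<alpha> = n} \<alpha>)"
      by (simp add: sums_iff)
  qed
  also have "\<dots> = (\<Sum>n. \<integral>\<^sup>+ \<alpha>. ?g \<alpha> * indicator {\<alpha>. mdeg \<alpha> = n} \<alpha> \<partial>count_space UNIV)"
    by (rule nn_integral_suminf) simp
  also have "\<dots> = (\<Sum>n. \<Sum>\<alpha> | mdeg \<alpha> = n. ?g \<alpha>)"
  proof (rule arg_cong[where f = suminf], rule ext)
    fix n
    have "(\<integral>\<^sup>+ \<alpha>. ?g \<alpha> * indicator {\<alpha>. mdeg \<alpha> = n} \<alpha> \<partial>count_space UNIV)
        = (\<Sum>\<alpha> | mdeg \<alpha> = n. ?g \<alpha> * indicator {\<alpha>. mdeg \<alpha> = n} \<alpha>)"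
      by (rule nn_integral_count_space') auto
    also have "\<dots> = (\<Sum>\<alpha> | mdeg \<alpha> = n. ?g \<alpha>)" by (intro sum.cong) auto
    finally show "(\<integral>\<^sup>+ \<alpha>. ?g \<alpha> * indicator {\<alpha>. mdeg \<alpha> = n} \<alpha> \<partial>count_space UNIV) = (\<Sum>\<alpha> | mdeg \<alpha> = n. ?g \<alpha>)" .
  qed
  finally show ?thesis by (simp add: sum_ennreal)
qed

text \<open>Monotone convergence in the degree reduces the identity to homogeneous components, where
it is the orthogonality of the monomials.\<close>

lemma slice_norm_identity:
  fixes \<mu> :: "(complex^'d) measure"
  assumes \<mu>: "reinhardt_sphere_measure \<mu>" and w: "\<And>\<alpha>. (w \<alpha>)\<^sup>2 = (\<gamma> (mdeg \<alpha>))\<^sup>2 * moment \<mu> \<alpha>"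
  shows "(\<integral>\<^sup>+ z. H2_sq \<gamma> (slice f z) \<partial>\<mu>) = H2_sq w f"
proof -
  have [measurable_cong]: "sets \<mu> = sets borel" by (rule reinhardt_facts[OF \<mu>])
  have "(\<integral>\<^sup>+ z. H2_sq \<gamma> (slice f z) \<partial>\<mu>) = (\<Sum>n. \<integral>\<^sup>+ z. ennreal ((cmod (slice f z n))\<^sup>2 * (\<gamma> n)\<^sup>2) \<partial>\<mu>)"
    unfolding H2_sq_nat by (rule nn_integral_suminf) measurable
  also have "\<dots> = (\<Sum>n. ennreal (\<integral>z. (cmod (slice f z n))\<^sup>2 * (\<gamma> n)\<^sup>2 \<partial>\<mu>))"
    by (intro arg_cong[where f = suminf] ext nn_integral_eq_integral integrable_continuous_sphere[OF \<mu>] continuous_intros)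
       auto
  also have "\<dots> = (\<Sum>n. ennreal (\<Sum>\<alpha> | mdeg \<alpha> = n. (cmod (f \<alpha>))\<^sup>2 * (w \<alpha>)\<^sup>2))"
    unfolding Bochner_Integration.integral_mult_left_zero integral_slice_sq[OF \<mu>] sum_distrib_right
    by (intro arg_cong[where f = suminf] ext arg_cong[where f = ennreal] sum.cong) (auto simp: w)
  finally show ?thesis by (simp add: H2_sq_by_degree)
qed

lemma measurable_H2_sq_slice [measurable]: "(\<lambda>z. H2_sq \<gamma> (slice f z)) \<in> borel_measurable borel"
  unfolding H2_sq_nat by measurable

lemma single_in_H2: "single i \<in> H2 w" and H2_sq_single: "H2_sq w (single i) = ennreal ((w i)\<^sup>2)"
proof -
  have "H2_sq w (single i) = (\<Sum>k\<in>{i}. ennreal ((cmod (single i k))\<^sup>2 * (w k)\<^sup>2))"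
    unfolding H2_sq_def by (rule nn_integral_count_space') (auto simp: single_def)
  also have "\<dots> = ennreal ((w i)\<^sup>2)" by (simp add: single_def)
  finally show *: "H2_sq w (single i) = ennreal ((w i)\<^sup>2)" .
  show "single i \<in> H2 w" by (simp add: H2_iff *)
qed

text \<open>One half tests the representation on monomials; the other half is the norm identity for general \<open>f\<close>.
From here on a slice representation is used only as a formula for the weights.\<close>

lemma has_slice_representation_iff:
  fixes \<mu> :: "(complex^'d) measure"
  shows "has_slice_representation w \<mu> \<gamma> \<longleftrightarrow>
     reinhardt_sphere_measure \<mu> \<and> (\<forall>\<alpha>. (w \<alpha>)\<^sup>2 = (\<gamma> (mdeg \<alpha>))\<^sup>2 * moment \<mu> \<alpha>)"
proof (cases "reinhardt_sphere_measure \<mu>")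
  case \<mu>: True
  have [measurable_cong]: "sets \<mu> = sets borel" by (rule reinhardt_facts[OF \<mu>])
  show ?thesis
  proof safe
    show "reinhardt_sphere_measure \<mu>" by fact
  next
    fix \<alpha>
    assume "has_slice_representation w \<mu> \<gamma>"
    then have "(\<integral>\<^sup>+ z. ennreal ((H2_norm \<gamma> (slice (single \<alpha>) z))\<^sup>2) \<partial>\<mu>) = ennreal ((H2_norm w (single \<alpha>))\<^sup>2)"
      and ae: "AE z in \<mu>. slice (single \<alpha>) z \<in> H2 \<gamma>"
      using single_in_H2[of \<alpha> w] by (auto simp: has_slice_representation_def)
    then have "ennreal ((w \<alpha>)\<^sup>2) = (\<integral>\<^sup>+ z. ennreal ((H2_norm \<gamma> (slice (single \<alpha>) z))\<^sup>2) \<partial>\<mu>)"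
      using H2_sq_eq[OF single_in_H2, of w \<alpha>] by (simp add: H2_sq_single)
    also have "\<dots> = (\<integral>\<^sup>+ z. H2_sq \<gamma> (slice (single \<alpha>) z) \<partial>\<mu>)"
      using ae by (intro nn_integral_cong_AE) (auto simp: H2_sq_eq)
    also have "\<dots> = (\<integral>\<^sup>+ z. ennreal ((\<gamma> (mdeg \<alpha>))\<^sup>2 * (cmod (zpow z \<alpha>))\<^sup>2) \<partial>\<mu>)"
    proof (rule nn_integral_cong)
      fix z
      have "slice (single \<alpha>) z = (\<lambda>n. zpow z \<alpha> * single (mdeg \<alpha>) n)"
        unfolding slice_single[abs_def] by (auto simp: single_def)
      then have "H2_sq \<gamma> (slice (single \<alpha>) z) = (\<Sum>n\<in>{mdeg \<alpha>}. ennreal ((cmod (zpow z \<alpha> * single (mdeg \<alpha>) n))\<^sup>2 * (\<gamma> n)\<^sup>2))"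
        unfolding H2_sq_def by (simp only:, intro nn_integral_count_space') (auto simp: single_def)
      then show "H2_sq \<gamma> (slice (single \<alpha>) z) = ennreal ((\<gamma> (mdeg \<alpha>))\<^sup>2 * (cmod (zpow z \<alpha>))\<^sup>2)"
        by (simp add: single_def mult_ac)
    qed
    also have "\<dots> = ennreal (\<integral>z. (\<gamma> (mdeg \<alpha>))\<^sup>2 * (cmod (zpow z \<alpha>))\<^sup>2 \<partial>\<mu>)"
      by (intro nn_integral_eq_integral integrable_continuous_sphere[OF \<mu>] continuous_intros) auto
    also have "\<dots> = ennreal ((\<gamma> (mdeg \<alpha>))\<^sup>2 * moment \<mu> \<alpha>)" by (simp add: moment_def)
    finally show "(w \<alpha>)\<^sup>2 = (\<gamma> (mdeg \<alpha>))\<^sup>2 * moment \<mu> \<alpha>" by (simp add: ennreal_inj)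
  next
    assume w: "\<forall>\<alpha>. (w \<alpha>)\<^sup>2 = (\<gamma> (mdeg \<alpha>))\<^sup>2 * moment \<mu> \<alpha>"
    show "has_slice_representation w \<mu> \<gamma>"
      unfolding has_slice_representation_def
    proof (intro conjI ballI \<mu>)
      fix f assume f: "f \<in> H2 w"
      have eq: "(\<integral>\<^sup>+ z. H2_sq \<gamma> (slice f z) \<partial>\<mu>) = H2_sq w f"
        by (rule slice_norm_identity[OF \<mu>]) (use w in auto)
      then have "(\<integral>\<^sup>+ z. H2_sq \<gamma> (slice f z) \<partial>\<mu>) \<noteq> \<infinity>" using f by (simp add: H2_iff)
      then have "AE z in \<mu>. H2_sq \<gamma> (slice f z) \<noteq> \<infinity>"
        by (intro nn_integral_PInf_AE) measurable
      then show ae: "AE z in \<mu>. slice f z \<in> H2 \<gamma>"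
        by (simp add: H2_iff less_top)
      have "(\<integral>\<^sup>+ z. ennreal ((H2_norm \<gamma> (slice f z))\<^sup>2) \<partial>\<mu>) = (\<integral>\<^sup>+ z. H2_sq \<gamma> (slice f z) \<partial>\<mu>)"
        using ae by (intro nn_integral_cong_AE) (auto simp: H2_sq_eq)
      then show "(\<integral>\<^sup>+ z. ennreal ((H2_norm \<gamma> (slice f z))\<^sup>2) \<partial>\<mu>) = ennreal ((H2_norm w f)\<^sup>2)"
        using eq f by (simp add: H2_sq_eq)
    qed
  qed
qed (simp add: has_slice_representation_def)

section \<open>Unitary matrices acting on the sphere\<close>

definition adjoint_matrix :: "complex^'d^'d \<Rightarrow> complex^'d^'d" where
  "adjoint_matrix u = (\<chi> i j. cnj (u $ j $ i))"

lemma unitary_adjoint: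
  assumes "unitary_matrix u"
  shows "u ** adjoint_matrix u = mat 1" "adjoint_matrix u ** u = mat 1"
  using assms unfolding unitary_matrix_def adjoint_matrix_def by auto

lemma adjoint_adjoint [simp]: "adjoint_matrix (adjoint_matrix u) = u"
  by (simp add: adjoint_matrix_def vec_eq_iff)

lemma unitary_matrix_iff: "unitary_matrix u \<longleftrightarrow> u ** adjoint_matrix u = mat 1"
  unfolding unitary_matrix_def adjoint_matrix_def[symmetric] by (simp add: matrix_left_right_inverse)

lemma unitary_matrix_adjoint: "unitary_matrix u \<Longrightarrow> unitary_matrix (adjoint_matrix u)"
  by (simp add: unitary_matrix_iff unitary_adjoint)

lemma adjoint_mult: "adjoint_matrix (u ** v) = adjoint_matrix v ** adjoint_matrix u"
  by (simp add: adjoint_matrix_def matrix_matrix_mult_def vec_eq_iff mult.commute)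

lemma unitary_matrix_mult:
  assumes "unitary_matrix u" "unitary_matrix v" shows "unitary_matrix (u ** v)"
  unfolding unitary_matrix_iff adjoint_mult
  by (metis assms matrix_mul_assoc matrix_mul_rid unitary_adjoint(1))

lemma unitary_matrix_1: "unitary_matrix (mat 1)"
  unfolding unitary_matrix_def by (simp add: mat_def matrix_matrix_mult_def vec_eq_iff if_distrib
     [where f = "\<lambda>x. cnj x"] if_distrib[where f = "\<lambda>x. _ * x"] if_distrib[where f = "\<lambda>x. x * _"] sum.delta cong: if_cong)

lemma norm_vec_complex: "of_real ((norm z)\<^sup>2) = (\<Sum>j\<in>UNIV. z $ j * cnj (z $ j))"
  for z :: "complex^'d"
  by (simp add: norm_vec_def L2_set_def sum_nonneg complex_norm_square[symmetric])

lemma norm_unitary: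
  assumes "unitary_matrix u" shows "norm (u *v z) = norm z"
proof -
  have u: "(\<Sum>j\<in>UNIV. u $ j $ k * cnj (u $ j $ l)) = (if k = l then 1 else 0)" for k l
  proof -
    have "(adjoint_matrix u ** u) $ l $ k = (mat 1 :: complex^'a^'a) $ l $ k" using unitary_adjoint[OF assms] by simp
    then show ?thesis by (auto simp: adjoint_matrix_def matrix_matrix_mult_def mat_def mult.commute)
  qed
  have "(of_real ((norm (u *v z))\<^sup>2) :: complex) =
      (\<Sum>j\<in>UNIV. \<Sum>k\<in>UNIV. \<Sum>l\<in>UNIV. (z $ k * cnj (z $ l)) * (u $ j $ k * cnj (u $ j $ l)))"
    unfolding norm_vec_complex by (simp add: matrix_vector_mult_def sum_product mult_ac)
  also have "\<dots> = (\<Sum>k\<in>UNIV. \<Sum>l\<in>UNIV. (z $ k * cnj (z $ l)) * (\<Sum>j\<in>UNIV. u $ j $ k * cnj (u $ j $ l)))"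
    unfolding sum_distrib_left by (rule trans[OF sum.swap], rule sum.cong[OF refl], rule sum.swap)
  also have "\<dots> = (\<Sum>k\<in>UNIV. z $ k * cnj (z $ k))"
    unfolding u by (intro sum.cong refl) (simp add: if_distrib cong: if_cong)
  also have "\<dots> = of_real ((norm z)\<^sup>2)" by (rule norm_vec_complex[symmetric])
  finally have "(norm (u *v z))\<^sup>2 = (norm z)\<^sup>2" by (simp only: of_real_eq_iff)
  then show ?thesis by (simp add: power2_eq_iff_nonneg)
qed

lemma unitary_cancel:
  assumes "unitary_matrix u"
  shows "adjoint_matrix u *v (u *v z) = z" "u *v (adjoint_matrix u *v z) = z"
  by (simp_all add: matrix_vector_mul_assoc unitary_adjoint[OF assms])

lemma continuous_on_matrix_vector [continuous_intros]:
  fixes u :: "'a::topological_space \<Rightarrow> complex^'d^'d"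
  assumes "continuous_on A u" "continuous_on A z"
  shows "continuous_on A (\<lambda>x. u x *v z x)"
  unfolding matrix_vector_mult_def by (intro continuous_intros assms)

lemma matrix_vector_measurable [measurable]:
  fixes u :: "complex^'d^'d" shows "(\<lambda>z. u *v z) \<in> borel_measurable borel"
  by (intro borel_measurable_continuous_onI continuous_intros)

text \<open>The witness is a complex Householder map \<open>I - v v\<^sup>* / c\<close> with \<open>v = x - y\<close> and \<open>c = v\<^sup>* x\<close>. It sends
\<open>x\<close> to \<open>x - v = y\<close>, and it is unitary since \<open>c + cnj c = |v|\<^sup>2\<close> for unit vectors; taking
\<open>c\<close> instead of \<open>|v|\<^sup>2 / 2\<close> spares the choice of a phase that makes the inner product of \<open>x\<close> and \<open>y\<close> real.\<close>

lemma unitary_transitive: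
  fixes x y :: "complex^'d"
  assumes "norm x = 1" "norm y = 1"
  shows "\<exists>u. unitary_matrix u \<and> u *v x = y"
proof (cases "x = y")
  case True
  then show ?thesis using unitary_matrix_1 by (intro exI[of _ "mat 1"]) simp
next
  case False
  define v where "v = x - y"
  define c where "c = (\<Sum>j\<in>UNIV. cnj (v $ j) * x $ j)"
  have x1: "(\<Sum>j\<in>UNIV. x $ j * cnj (x $ j)) = 1" and y1: "(\<Sum>j\<in>UNIV. y $ j * cnj (y $ j)) = 1"
    using norm_vec_complex[of x] norm_vec_complex[of y] assms by auto
  have cc: "c + cnj c = (\<Sum>j\<in>UNIV. v $ j * cnj (v $ j))"
  proof -
    have "c + cnj c - (\<Sum>j\<in>UNIV. v $ j * cnj (v $ j))
        = (\<Sum>j\<in>UNIV. x $ j * cnj (x $ j)) - (\<Sum>j\<in>UNIV. y $ j * cnj (y $ j))"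
      unfolding c_def v_def cnj_sum sum.distrib[symmetric] sum_subtractf[symmetric]
      by (intro sum.cong refl) (simp add: algebra_simps)
    then show ?thesis by (simp add: x1 y1)
  qed
  have "norm v \<noteq> 0" using False by (simp add: v_def)
  then have "c + cnj c \<noteq> 0" unfolding cc norm_vec_complex[symmetric] by simp
  then have c0: "c \<noteq> 0" by auto
  define u where "u = (\<chi> i j. (if i = j then 1 else 0) - v $ i * cnj (v $ j) / c)"
  have "(u ** adjoint_matrix u) $ i $ j = (mat 1 :: complex^'d^'d) $ i $ j" for i j
  proof -
    have "(u ** adjoint_matrix u) $ i $ j =
       (\<Sum>k\<in>UNIV. (if i = k then (if j = k then 1 else 0) else 0) - (if i = k then v $ k * cnj (v $ j) / cnj c else 0)
         - (if j = k then v $ i * cnj (v $ k) / c else 0)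
         + (v $ i * cnj (v $ j) / (c * cnj c)) * (v $ k * cnj (v $ k)))"
      unfolding matrix_matrix_mult_def adjoint_matrix_def u_def
      by (simp, intro sum.cong refl) (auto simp: algebra_simps)
    also have "\<dots> = (if j = i then 1 else 0) - v $ i * cnj (v $ j) / cnj c - v $ i * cnj (v $ j) / c
        + (v $ i * cnj (v $ j) / (c * cnj c)) * (c + cnj c)"
      unfolding cc sum_distrib_left by (simp add: sum.distrib sum_subtractf)
    also have "\<dots> = (if j = i then 1 else 0)"
      using c0 by (simp add: field_simps)
    finally show ?thesis by (auto simp: mat_def)
  qed
  then have "unitary_matrix u" unfolding unitary_matrix_iff by (simp add: vec_eq_iff)
  moreover have "u *v x = y"
  proof -
    have "(u *v x) $ i = y $ i" for i
    proof -
      have "(u *v x) $ i = (\<Sum>j\<in>UNIV. (if i = j then x $ j else 0) - (v $ i / c) * (cnj (v $ j) * x $ j))"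
        unfolding matrix_vector_mult_def u_def by (simp, intro sum.cong refl) (auto simp: algebra_simps)
      also have "\<dots> = x $ i - (v $ i / c) * c"
        unfolding c_def sum_distrib_left by (simp add: sum_subtractf)
      finally show ?thesis using c0 by (simp add: v_def)
    qed
    then show ?thesis by (simp add: vec_eq_iff)
  qed
  ultimately show ?thesis by blast
qed

section \<open>Unitary invariance of Lebesgue and surface measure\<close>

lemma matrix_vector_real_linear: "linear (\<lambda>z. u *v z)" for u :: "complex^'d^'d"
  by (rule linearI) (auto simp: matrix_vector_mult_def vec_eq_iff distrib_left sum.distrib scaleR_sum_right)

lemma nn_integral_lborel_translate:
  fixes f :: "'a::euclidean_space \<Rightarrow> ennreal"
  assumes [measurable]: "f \<in> borel_measurable borel"
  shows "(\<integral>\<^sup>+ y. f (c + y) \<partial>lborel) = (\<integral>\<^sup>+ y. f y \<partial>lborel)"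
proof -
  have "(\<integral>\<^sup>+ y. f y \<partial>lborel) = (\<integral>\<^sup>+ y. f y \<partial>distr lborel borel ((+) c))" by (simp add: lborel_distr_plus)
  also have "\<dots> = (\<integral>\<^sup>+ y. f (c + y) \<partial>lborel)" by (rule nn_integral_distr) auto
  finally show ?thesis by simp
qed

lemma nn_integral_lborel_reflect:
  fixes f :: "'a::euclidean_space \<Rightarrow> ennreal"
  assumes [measurable]: "f \<in> borel_measurable borel"
  shows "(\<integral>\<^sup>+ y. f (- y) \<partial>lborel) = (\<integral>\<^sup>+ y. f y \<partial>lborel)"
proof -
  have "lborel = distr lborel borel (\<lambda>x :: 'a. - x)"
    using lborel_affine[of "-1" "0 :: 'a"] by (simp add: density_1 one_ennreal_def[symmetric])
  then have "(\<integral>\<^sup>+ y. f y \<partial>lborel) = (\<integral>\<^sup>+ y. f y \<partial>distr lborel borel (\<lambda>x :: 'a. - x))" by simp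
  also have "\<dots> = (\<integral>\<^sup>+ y. f (- y) \<partial>lborel)" by (rule nn_integral_distr) auto
  finally show ?thesis by simp
qed

text \<open>Weil's uniqueness argument: the double integral of \<open>f(x) g(x + y)\<close> over \<open>\<nu>\<close> in \<open>x\<close> and Lebesgue measure in
\<open>y\<close> is \<open>\<nu>(f) \<cdot> \<lambda>(g)\<close> by translation in \<open>y\<close>, and after a translation in \<open>x\<close> and a reflection in \<open>y\<close> it is
\<open>\<lambda>(f) \<cdot> \<nu>(g)\<close>. The normalization on the unit ball, taken for \<open>g\<close>, then gives equality.\<close>

lemma translation_invariant_eq_lborel:
  fixes \<nu> :: "'a::euclidean_space measure"
  assumes [measurable_cong]: "sets \<nu> = sets borel" and "sigma_finite_measure \<nu>"
    and trans: "\<And>f c. f \<in> borel_measurable borel \<Longrightarrow> (\<integral>\<^sup>+ y. f (c + y) \<partial>\<nu>) = (\<integral>\<^sup>+ y. f y \<partial>\<nu>)"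
    and ball: "emeasure \<nu> (ball 0 1) = emeasure lborel (ball (0 :: 'a) 1)"
  shows "\<nu> = lborel"
proof (rule measure_eqI)
  interpret \<nu>: sigma_finite_measure \<nu> by fact
  interpret pair_sigma_finite \<nu> lborel ..
  let ?B = "ball (0 :: 'a) 1"
  fix A assume "A \<in> sets \<nu>"
  then have A [measurable]: "A \<in> sets borel" using assms(1) by simp
  define f :: "'a \<Rightarrow> ennreal" where "f = indicator A"
  define g :: "'a \<Rightarrow> ennreal" where "g = indicator ?B"
  have [measurable]: "f \<in> borel_measurable borel" "g \<in> borel_measurable borel"
    by (auto simp: f_def g_def intro!: borel_measurable_indicator)
  \<comment> \<open>Translate in \<open>y\<close>, exchange, translate in \<open>x\<close> by \<open>-y\<close>, exchange back, reflect in \<open>y\<close>.\<close>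
  have "(\<integral>\<^sup>+ x. f x \<partial>\<nu>) * (\<integral>\<^sup>+ y. g y \<partial>lborel) = (\<integral>\<^sup>+ x. (\<integral>\<^sup>+ y. f x * g (x + y) \<partial>lborel) \<partial>\<nu>)"
    by (simp add: nn_integral_cmult nn_integral_lborel_translate nn_integral_multc)
  also have "\<dots> = (\<integral>\<^sup>+ y. (\<integral>\<^sup>+ x. f x * g (x + y) \<partial>\<nu>) \<partial>lborel)"
    by (rule Fubini'[symmetric]) measurable
  also have "\<dots> = (\<integral>\<^sup>+ y. (\<integral>\<^sup>+ x. f (- y + x) * g x \<partial>\<nu>) \<partial>lborel)"
  proof (rule nn_integral_cong)
    fix y
    show "(\<integral>\<^sup>+ x. f x * g (x + y) \<partial>\<nu>) = (\<integral>\<^sup>+ x. f (- y + x) * g x \<partial>\<nu>)"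
      using trans[of "\<lambda>x. f x * g (x + y)" "- y"] by simp
  qed
  also have "\<dots> = (\<integral>\<^sup>+ x. (\<integral>\<^sup>+ y. f (- y + x) * g x \<partial>lborel) \<partial>\<nu>)"
    by (rule Fubini') measurable
  also have "\<dots> = (\<integral>\<^sup>+ x. (\<integral>\<^sup>+ y. f (y + x) * g x \<partial>lborel) \<partial>\<nu>)"
  proof (rule nn_integral_cong)
    fix x
    show "(\<integral>\<^sup>+ y. f (- y + x) * g x \<partial>lborel) = (\<integral>\<^sup>+ y. f (y + x) * g x \<partial>lborel)"
      by (rule nn_integral_lborel_reflect[of "\<lambda>y. f (y + x) * g x"]) measurable
  qed
  also have "\<dots> = (\<integral>\<^sup>+ x. (\<integral>\<^sup>+ y. f y \<partial>lborel) * g x \<partial>\<nu>)"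
    using nn_integral_lborel_translate[of f]
    by (simp add: nn_integral_multc add.commute)
  also have "\<dots> = (\<integral>\<^sup>+ y. f y \<partial>lborel) * (\<integral>\<^sup>+ x. g x \<partial>\<nu>)"
    by (rule nn_integral_cmult) measurable
  finally have "emeasure \<nu> A * emeasure lborel ?B = emeasure lborel A * emeasure lborel ?B"
    unfolding f_def g_def using A assms(1) by (simp add: ball)
  moreover have "emeasure lborel ?B \<noteq> 0" "emeasure lborel ?B \<noteq> \<infinity>"
    using emeasure_lborel_ball_finite[of "0 :: 'a" 1] content_ball_pos[of 1 "0 :: 'a"]
    by (auto simp: measure_def)
  ultimately show "emeasure \<nu> A = emeasure lborel A"
    by (metis mult_divide_eq_ennreal infinity_ennreal_def)
qed (use assms in auto)

text \<open>The image measure is translation invariant because \<open>u\<close> is linear and onto, and it gives the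
unit ball the right mass because \<open>u\<close> maps the ball onto itself. So no determinant is computed.\<close>

lemma lborel_unitary:
  fixes u :: "complex^'d^'d"
  assumes u: "unitary_matrix u"
  shows "distr lborel borel (\<lambda>z. u *v z) = lborel"
proof (rule translation_invariant_eq_lborel)
  let ?\<nu> = "distr lborel borel (\<lambda>z. u *v z)"
  let ?v = "adjoint_matrix u"
  have vim: "(\<lambda>z. u *v z) -` ball 0 r \<inter> space lborel = ball 0 r" for r
    using norm_unitary[OF u] by auto
  have eB: "emeasure ?\<nu> (ball 0 r) = emeasure lborel (ball (0 :: complex^'d) r)" for r
    by (subst emeasure_distr) (simp_all only: vim, auto)
  show "sets ?\<nu> = sets borel" by simp
  show "emeasure ?\<nu> (ball 0 1) = emeasure lborel (ball (0 :: complex^'d) 1)" by (rule eB)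
  show "sigma_finite_measure ?\<nu>"
  proof (rule sigma_finite_measure.intro, intro exI[of _ "range (\<lambda>n :: nat. ball 0 (real n))"] conjI ballI)
    show "\<Union> (range (\<lambda>n :: nat. ball 0 (real n))) = space ?\<nu>"
      using reals_Archimedean2 by auto
    show "emeasure ?\<nu> a \<noteq> \<infinity>" if "a \<in> range (\<lambda>n :: nat. ball 0 (real n))" for a
      using that emeasure_lborel_ball_finite by (auto simp: eB less_top)
  qed auto
  fix f :: "complex^'d \<Rightarrow> ennreal" and c
  assume [measurable]: "f \<in> borel_measurable borel"
  have "(\<integral>\<^sup>+ y. f (c + y) \<partial>?\<nu>) = (\<integral>\<^sup>+ y. f (c + u *v y) \<partial>lborel)"
    by (rule nn_integral_distr) auto
  also have "\<dots> = (\<integral>\<^sup>+ y. f (u *v (?v *v c + y)) \<partial>lborel)"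
    by (simp add: matrix_vector_right_distrib unitary_cancel[OF u])
  also have "\<dots> = (\<integral>\<^sup>+ y. f (u *v y) \<partial>lborel)"
    by (rule nn_integral_lborel_translate[of "\<lambda>y. f (u *v y)"]) measurable
  also have "\<dots> = (\<integral>\<^sup>+ y. f y \<partial>?\<nu>)"
    by (rule nn_integral_distr[symmetric]) auto
  finally show "(\<integral>\<^sup>+ y. f (c + y) \<partial>?\<nu>) = (\<integral>\<^sup>+ y. f y \<partial>?\<nu>)" .
qed

text \<open>Unitary maps commute with the radial projection, so the invariance of Lebesgue measure
on the ball descends to the sphere.\<close>

lemma surface_measure_unitary:
  fixes u :: "complex^'d^'d"
  assumes u: "unitary_matrix u"
  shows "distr normalized_surface_measure borel (\<lambda>z. u *v z) = (normalized_surface_measure :: (complex^'d) measure)"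
proof -
  let ?m = "uniform_measure lborel (ball (0 :: complex^'d) 1)"
  let ?h = "\<lambda>z :: complex^'d. z /\<^sub>R norm z"
  have m: "distr ?m borel (\<lambda>z. u *v z) = ?m"
  proof (rule measure_eqI)
    fix A assume "A \<in> sets (distr ?m borel (\<lambda>z. u *v z))"
    then have A [measurable]: "A \<in> sets borel" by simp
    have "emeasure (distr ?m borel (\<lambda>z. u *v z)) A = emeasure ?m ((\<lambda>z. u *v z) -` A)"
      by (subst emeasure_distr) auto
    also have "\<dots> = emeasure lborel (ball 0 1 \<inter> (\<lambda>z. u *v z) -` A) / emeasure lborel (ball (0 :: complex^'d) 1)"
      using measurable_sets[OF matrix_vector_measurable[of u] A] by simp
    also have "ball 0 1 \<inter> (\<lambda>z. u *v z) -` A = (\<lambda>z. u *v z) -` (ball 0 1 \<inter> A)"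
      using norm_unitary[OF u] by auto
    also have "emeasure lborel \<dots> = emeasure (distr lborel borel (\<lambda>z. u *v z)) (ball 0 1 \<inter> A)"
      by (subst emeasure_distr) auto
    also have "\<dots> = emeasure lborel (ball 0 1 \<inter> A)" by (simp add: lborel_unitary[OF u])
    finally show "emeasure (distr ?m borel (\<lambda>z. u *v z)) A = emeasure ?m A" by simp
  qed simp
  have comm: "(\<lambda>z. u *v z) \<circ> ?h = ?h \<circ> (\<lambda>z. u *v z)"
    by (rule ext) (simp add: norm_unitary[OF u] linear_scale[OF matrix_vector_real_linear])
  have "distr normalized_surface_measure borel (\<lambda>z. u *v z) = distr ?m borel ((\<lambda>z. u *v z) \<circ> ?h)"
    unfolding normalized_surface_measure_def by (rule distr_distr) auto
  also have "\<dots> = distr (distr ?m borel (\<lambda>z. u *v z)) borel ?h"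
    unfolding comm by (rule distr_distr[symmetric]) auto
  finally show ?thesis unfolding m normalized_surface_measure_def .
qed

lemma emeasure_surface_measure: "emeasure (normalized_surface_measure :: (complex^'d) measure) UNIV = 1"
proof -
  have "emeasure (normalized_surface_measure :: (complex^'d) measure) UNIV
      = emeasure (uniform_measure lborel (ball (0 :: complex^'d) 1)) UNIV"
    unfolding normalized_surface_measure_def by (subst emeasure_distr) auto
  also have "\<dots> = 1"
    using emeasure_lborel_ball_finite[of "0 :: complex^'d" 1] content_ball_pos[of 1 "0 :: complex^'d"]
    by (subst emeasure_uniform_measure) (auto simp: measure_def intro!: ennreal_divide_self)
  finally show ?thesis .
qed

lemma reinhardt_surface_measure:
  "reinhardt_sphere_measure (normalized_surface_measure :: (complex^'d) measure)"
  unfolding reinhardt_sphere_measure_def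
proof (intro conjI allI impI)
  let ?m = "uniform_measure lborel (ball (0 :: complex^'d) 1)"
  let ?h = "\<lambda>z :: complex^'d. z /\<^sub>R norm z"
  show "sets (normalized_surface_measure :: (complex^'d) measure) = sets borel"
    by (simp add: normalized_surface_measure_def)
  show "finite_measure (normalized_surface_measure :: (complex^'d) measure)"
  proof (rule finite_measureI)
    have "space (normalized_surface_measure :: (complex^'d) measure) = UNIV" by (simp add: normalized_surface_measure_def)
    then show "emeasure (normalized_surface_measure :: (complex^'d) measure) (space normalized_surface_measure) \<noteq> \<infinity>"
      by (simp add: emeasure_surface_measure)
  qed
  have "emeasure (normalized_surface_measure :: (complex^'d) measure) (- sphere 0 1) = emeasure ?m (?h -` (- sphere 0 1))"
    unfolding normalized_surface_measure_def by (subst emeasure_distr) auto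
  also have "?h -` (- sphere 0 1) = {0}"
    by (auto simp: field_simps split: if_splits)
  also have "emeasure ?m {0} = 0" by simp
  finally show "emeasure (normalized_surface_measure :: (complex^'d) measure) (- sphere 0 1) = 0" .
  fix t :: "complex^'d"
  assume t: "\<forall>j. cmod (t $ j) = 1"
  define u :: "complex^'d^'d" where "u = (\<chi> i j. if i = j then t $ i else 0)"
  have tt: "t $ j * cnj (t $ j) = 1" for j
    using t by (metis complex_norm_square of_real_1 power_one)
  have "(u ** adjoint_matrix u) $ i $ j = (mat 1 :: complex^'d^'d) $ i $ j" for i j
  proof -
    have "(u ** adjoint_matrix u) $ i $ j = (\<Sum>k\<in>UNIV. if i = k then (if j = k then t $ k * cnj (t $ k) else 0) else 0)"
      unfolding matrix_matrix_mult_def adjoint_matrix_def u_def vec_lambda_beta by (intro sum.cong refl) auto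
    then show ?thesis by (auto simp: mat_def tt)
  qed
  then have u: "unitary_matrix u" unfolding unitary_matrix_iff by (simp add: vec_eq_iff)
  have "(\<lambda>z. \<chi> j. t $ j * z $ j) = (\<lambda>z. u *v z)"
  proof
    fix z :: "complex^'d"
    have "(u *v z) $ i = t $ i * z $ i" for i
    proof -
      have "(u *v z) $ i = (\<Sum>j\<in>UNIV. if i = j then t $ j * z $ j else 0)"
        unfolding matrix_vector_mult_def u_def by (simp add: if_distrib if_distribR cong: if_cong)
      then show ?thesis by simp
    qed
    then show "(\<chi> j. t $ j * z $ j) = u *v z" by (simp add: vec_eq_iff)
  qed
  then show "distr normalized_surface_measure borel (\<lambda>z. \<chi> j. t $ j * z $ j) = normalized_surface_measure"
    using surface_measure_unitary[OF u] by simp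
qed

lemma integral_surface_unitary:
  fixes F :: "complex^'d \<Rightarrow> real"
  assumes "unitary_matrix u" and [measurable]: "F \<in> borel_measurable borel"
  shows "(\<integral>z. F (u *v z) \<partial>normalized_surface_measure) = (\<integral>z. F z \<partial>normalized_surface_measure)"
proof -
  have m: "(\<lambda>z. u *v z) \<in> normalized_surface_measure \<rightarrow>\<^sub>M borel"
    unfolding measurable_cong_sets[OF reinhardt_facts(2)[OF reinhardt_surface_measure] refl] by measurable
  have "(\<integral>z. F z \<partial>normalized_surface_measure) = (\<integral>z. F z \<partial>distr normalized_surface_measure borel (\<lambda>z. u *v z))"
    by (simp add: surface_measure_unitary[OF assms(1)])
  also have "\<dots> = (\<integral>z. F (u *v z) \<partial>normalized_surface_measure)"
    by (rule integral_distr[OF m]) measurable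
  finally show ?thesis by simp
qed

section \<open>Averaging over the unitary group by finite means\<close>

text \<open>The functions reached from \<open>F\<close> by repeatedly taking finite means of unitary translates. Finite
means replace integration against Haar measure: every inequality that holds uniformly for all
translates of \<open>F\<close> passes to them by induction.\<close>

inductive unitary_average :: "(complex^'d \<Rightarrow> real) \<Rightarrow> (complex^'d \<Rightarrow> real) \<Rightarrow> bool"
  for F :: "complex^'d \<Rightarrow> real" where
  base: "unitary_average F F"
| step: "unitary_average F g \<Longrightarrow> finite (K :: (complex^'d) set) \<Longrightarrow> K \<noteq> {} \<Longrightarrow>
    (\<And>w. w \<in> K \<Longrightarrow> unitary_matrix (U w :: complex^'d^'d)) \<Longrightarrow>
    unitary_average F (\<lambda>z. (\<Sum>w\<in>K. g (U w *v z)) / real (card K))"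

lemma mean_le:
  fixes h :: "'a \<Rightarrow> real"
  assumes "finite K" "K \<noteq> {}" "\<And>w. w \<in> K \<Longrightarrow> h w \<le> b"
  shows "(\<Sum>w\<in>K. h w) / real (card K) \<le> b"
  using sum_bounded_above[of K h b] assms by (simp add: divide_le_eq card_gt_0_iff mult.commute)

lemma mean_ge:
  fixes h :: "'a \<Rightarrow> real"
  assumes "finite K" "K \<noteq> {}" "\<And>w. w \<in> K \<Longrightarrow> b \<le> h w"
  shows "b \<le> (\<Sum>w\<in>K. h w) / real (card K)"
  using sum_bounded_below[of K b h] assms by (simp add: le_divide_eq card_gt_0_iff mult.commute)

lemma unitary_average_continuous:
  assumes "unitary_average F g" "continuous_on UNIV F" shows "continuous_on UNIV g"
  using assms
proof induction
  case (step g K U)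
  then show ?case
    by (intro continuous_on_divide continuous_on_sum continuous_on_const
        continuous_on_compose2[OF step.IH[OF step.prems]] continuous_intros) auto
qed

lemma dist_unitary: "unitary_matrix u \<Longrightarrow> dist (u *v x) (u *v y) = dist x y"
  by (simp add: dist_norm matrix_vector_mult_diff_distrib[symmetric] norm_unitary)

text \<open>All averages inherit one and the same modulus of continuity, because unitary maps are isometries.
This equicontinuity lets every average be lowered by the same amount.\<close>

lemma unitary_average_modulus:
  assumes "unitary_average F g"
    and F: "\<And>x y. norm x = 1 \<Longrightarrow> norm y = 1 \<Longrightarrow> dist x y < \<delta> \<Longrightarrow> F x \<le> F y + e"
  shows "norm x = 1 \<Longrightarrow> norm y = 1 \<Longrightarrow> dist x y < \<delta> \<Longrightarrow> g x \<le> g y + e"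
  using assms(1)
proof (induction arbitrary: x y)
  case base
  then show ?case by (rule F)
next
  case (step g K U)
  have "(\<Sum>w\<in>K. g (U w *v x) - g (U w *v y)) / real (card K) \<le> e"
  proof (rule mean_le)
    fix w assume w: "w \<in> K"
    have "g (U w *v x) \<le> g (U w *v y) + e"
      using step.prems step.hyps(4)[OF w] by (intro step.IH) (simp_all add: norm_unitary dist_unitary)
    then show "g (U w *v x) - g (U w *v y) \<le> e" by simp
  qed (use step in auto)
  then show ?case by (simp add: sum_subtractf diff_divide_distrib)
qed

lemma unitary_average_lower_bound:
  assumes "unitary_average F g" and F: "\<And>x. norm x = 1 \<Longrightarrow> b \<le> F x"
  shows "norm x = 1 \<Longrightarrow> b \<le> g x"
  using assms(1)
proof (induction arbitrary: x)
  case (step g K U)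
  then show ?case by (intro mean_ge) (simp_all add: norm_unitary)
qed (rule F)

text \<open>If every average oscillated by more than \<open>e\<close>, each could be improved: it lies \<open>e\<close> below its
upper bound \<open>M\<close> at some \<open>z\<^sub>0\<close>, hence \<open>e / 2\<close> below on a ball whose radius does not depend on the average.
Finitely many such balls cover the sphere, and unitary maps carry each of their centres to \<open>z\<^sub>0\<close>, so
the mean of these translates lies below \<open>M\<close> by a fixed amount \<open>\<eta>\<close>. Repeating this contradicts the
lower bound of \<open>F\<close>.\<close>

lemma averages_nearly_constant:
  fixes F :: "complex^'d \<Rightarrow> real"
  assumes F: "continuous_on UNIV F" and e: "e > 0"
  shows "\<exists>g c. unitary_average F g \<and> (\<forall>z. norm z = 1 \<longrightarrow> \<bar>g z - c\<bar> \<le> e)"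
proof (rule ccontr)
  assume contra: "\<not> ?thesis"
  let ?S = "sphere (0 :: complex^'d) 1"
  have FS: "continuous_on ?S F" using F by (rule continuous_on_subset) auto
  have "uniformly_continuous_on ?S F" by (rule compact_uniformly_continuous[OF FS]) simp
  then obtain \<delta> where \<delta>: "\<delta> > 0" "\<And>x y. x \<in> ?S \<Longrightarrow> y \<in> ?S \<Longrightarrow> dist y x < \<delta> \<Longrightarrow> dist (F y) (F x) < e / 2"
    using e unfolding uniformly_continuous_on_def by (metis half_gt_zero)
  have modF: "F x \<le> F y + e / 2" if "norm x = 1" "norm y = 1" "dist x y < \<delta>" for x y
    using \<delta>(2)[of y x] that unfolding dist_real_def abs_less_iff by fastforce
  have "bounded (F ` ?S)" by (intro compact_imp_bounded compact_continuous_image FS) simp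
  then obtain B where B: "\<And>z. norm z = 1 \<Longrightarrow> \<bar>F z\<bar> \<le> B"
    unfolding bounded_iff by fastforce
  obtain K where K: "finite K" "K \<subseteq> ?S" "?S \<subseteq> (\<Union>w\<in>K. ball w \<delta>)"
    using compactE_image[of ?S ?S "\<lambda>w. ball w \<delta>"] \<delta>(1) by force
  obtain a :: "complex^'d" where a: "norm a = 1" by (rule vector_choose_size[of 1]) auto
  then have K0: "K \<noteq> {}" using K(3) by auto
  \<comment> \<open>One of the \<open>card K\<close> terms of the mean drops by \<open>e / 2\<close>.\<close>
  define \<eta> where "\<eta> = e / (2 * real (card K))"
  have N: "real (card K) > 0" using K(1) K0 by (simp add: card_gt_0_iff)
  then have \<eta>: "\<eta> > 0" using e by (simp add: \<eta>_def)
  have decrease: "\<exists>g'. unitary_average F g' \<and> (\<forall>z. norm z = 1 \<longrightarrow> g' z \<le> M - \<eta>)"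
    if g: "unitary_average F g" "\<forall>z. norm z = 1 \<longrightarrow> g z \<le> M" for g M
  proof -
    obtain z0 where z0: "norm z0 = 1" "g z0 < M - e"
    proof (rule ccontr)
      assume "\<not> thesis"
      then have "\<forall>z. norm z = 1 \<longrightarrow> \<bar>g z - M\<bar> \<le> e" using that g(2) by fastforce
      then show False using contra g(1) by blast
    qed
    have "\<forall>w\<in>K. \<exists>u. unitary_matrix u \<and> u *v w = z0"
      using K(2) z0(1) by (auto intro!: unitary_transitive)
    then obtain U where U: "\<And>w. w \<in> K \<Longrightarrow> unitary_matrix (U w)" "\<And>w. w \<in> K \<Longrightarrow> U w *v w = z0"
      by metis
    let ?g = "\<lambda>z. (\<Sum>w\<in>K. g (U w *v z)) / real (card K)"
    have "?g z \<le> M - \<eta>" if z: "norm z = 1" for z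
    proof -
      obtain w where w: "w \<in> K" "dist w z < \<delta>" using K(3) z by (auto simp: subset_iff)
      have "g (U w *v z) \<le> g z0 + e / 2"
        using w U[OF w(1)] z z0(1) dist_unitary[OF U(1)[OF w(1)], of z w]
        by (intro unitary_average_modulus[OF g(1) modF]) (auto simp: norm_unitary dist_commute)
      then have 1: "g (U w *v z) \<le> M - e / 2" using z0(2) by simp
      have "(\<Sum>v\<in>K - {w}. g (U v *v z)) \<le> real (card (K - {w})) * M"
        using U(1) z g(2) by (intro sum_bounded_above) (simp add: norm_unitary)
      then have "(\<Sum>v\<in>K. g (U v *v z)) \<le> M - e / 2 + real (card (K - {w})) * M"
        using 1 K(1) w(1) by (simp add: sum.remove)
      also have "\<dots> = real (card K) * M - e / 2"
      proof -
        have "card K = Suc (card (K - {w}))" using card.remove[OF K(1) w(1)] .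
        then show ?thesis by (simp add: algebra_simps)
      qed
      also have "\<dots> = real (card K) * (M - \<eta>)" using N by (simp add: \<eta>_def field_simps)
      finally show ?thesis using N by (simp add: divide_le_eq mult.commute)
    qed
    moreover have "unitary_average F ?g" by (rule unitary_average.step[OF g(1) K(1) K0 U(1)])
    ultimately show ?thesis by blast
  qed
  have "\<exists>g. unitary_average F g \<and> (\<forall>z. norm z = 1 \<longrightarrow> g z \<le> B - real k * \<eta>)" for k
  proof (induction k)
    case 0
    then show ?case using unitary_average.base[of F] B by (intro exI[of _ F]) (auto simp: abs_le_iff)
  next
    case (Suc k)
    then obtain g where "unitary_average F g" "\<forall>z. norm z = 1 \<longrightarrow> g z \<le> B - real k * \<eta>" by blast
    from decrease[OF this] show ?case by (simp add: algebra_simps)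
  qed
  moreover obtain k :: nat where k: "real k * \<eta> > 2 * B" using reals_Archimedean3[OF \<eta>] by blast
  ultimately obtain g where g: "unitary_average F g" "\<And>z. norm z = 1 \<Longrightarrow> g z \<le> B - real k * \<eta>" by blast
  have "- B \<le> g a"
    by (rule unitary_average_lower_bound[OF g(1) _ a]) (use B in \<open>auto simp: abs_le_iff minus_le_iff\<close>)
  then show False using g(2)[OF a] k by simp
qed

lemma integral_near_constant:
  fixes g :: "complex^'d \<Rightarrow> real"
  assumes \<mu>: "reinhardt_sphere_measure \<mu>" and g: "continuous_on UNIV g"
    and c: "\<And>z. norm z = 1 \<Longrightarrow> \<bar>g z - c\<bar> \<le> e"
  shows "\<bar>(\<integral>z. g z \<partial>\<mu>) - c * measure \<mu> UNIV\<bar> \<le> e * measure \<mu> UNIV"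
proof -
  interpret finite_measure \<mu> by (rule reinhardt_facts[OF \<mu>])
  have int: "integrable \<mu> h" if "continuous_on UNIV h" for h :: "complex^'d \<Rightarrow> real"
    using integrable_continuous_sphere[OF \<mu> that] .
  have sp: "space \<mu> = UNIV" by (rule reinhardt_facts[OF \<mu>])
  have "(\<integral>z. g z \<partial>\<mu>) - c * measure \<mu> UNIV = (\<integral>z. g z - c \<partial>\<mu>)"
    using int[OF g] by (simp add: sp mult.commute)
  also have "\<bar>\<dots>\<bar> \<le> (\<integral>z. \<bar>g z - c\<bar> \<partial>\<mu>)" by (rule integral_abs_bound)
  also have "\<dots> \<le> (\<integral>z. e \<partial>\<mu>)"
  proof (rule integral_mono_AE)
    show "AE z in \<mu>. \<bar>g z - c\<bar> \<le> e" using reinhardt_facts(4)[OF \<mu>] by eventually_elim (rule c)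
  qed (auto intro!: int continuous_intros g)
  also have "\<dots> = e * measure \<mu> UNIV" by (simp add: sp mult.commute)
  finally show ?thesis .
qed

lemma unitary_average_integral_surface:
  assumes "unitary_average F g" "continuous_on UNIV F"
  shows "(\<integral>z. g z \<partial>normalized_surface_measure) = (\<integral>z. F z \<partial>normalized_surface_measure)"
  using assms
proof induction
  case (step g K U)
  note cg = unitary_average_continuous[OF step.hyps(1) step.prems]
  have "(\<integral>z. (\<Sum>w\<in>K. g (U w *v z)) / real (card K) \<partial>normalized_surface_measure)
      = (\<Sum>w\<in>K. \<integral>z. g (U w *v z) \<partial>normalized_surface_measure) / real (card K)"
    by (subst Bochner_Integration.integral_divide_zero, subst Bochner_Integration.integral_sum)
       (auto intro!: integrable_continuous_sphere[OF reinhardt_surface_measure]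
         continuous_on_compose2[OF cg] continuous_intros)
  also have "\<dots> = (\<Sum>w\<in>K. \<integral>z. F z \<partial>normalized_surface_measure) / real (card K)"
    using step.IH[OF step.prems] step.hyps(4) borel_measurable_continuous_onI[OF cg]
    by (simp add: integral_surface_unitary)
  finally show ?case using step.hyps by simp
qed simp

lemma unitary_average_integral_bounds:
  fixes F :: "complex^'d \<Rightarrow> real"
  assumes "unitary_average F g" and F: "continuous_on UNIV F" and \<mu>: "reinhardt_sphere_measure \<mu>"
    and b: "\<And>v. unitary_matrix v \<Longrightarrow> a \<le> (\<integral>z. F (v *v z) \<partial>\<mu>) \<and> (\<integral>z. F (v *v z) \<partial>\<mu>) \<le> b"
  shows "unitary_matrix v \<Longrightarrow> a \<le> (\<integral>z. g (v *v z) \<partial>\<mu>) \<and> (\<integral>z. g (v *v z) \<partial>\<mu>) \<le> b"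
  using assms(1)
proof (induction arbitrary: v)
  case base
  then show ?case by (rule b)
next
  case (step g K U)
  note cg = unitary_average_continuous[OF step.hyps(1) F]
  have "(\<integral>z. (\<Sum>w\<in>K. g (U w *v (v *v z))) / real (card K) \<partial>\<mu>)
      = (\<Sum>w\<in>K. \<integral>z. g ((U w ** v) *v z) \<partial>\<mu>) / real (card K)"
    by (subst Bochner_Integration.integral_divide_zero, subst Bochner_Integration.integral_sum)
       (auto intro!: integrable_continuous_sphere[OF \<mu>] simp: matrix_vector_mul_assoc
         intro: continuous_on_compose2[OF cg] continuous_intros)
  moreover have "a \<le> (\<integral>z. g ((U w ** v) *v z) \<partial>\<mu>) \<and> (\<integral>z. g ((U w ** v) *v z) \<partial>\<mu>) \<le> b" if "w \<in> K" for w
    using that step by (intro step.IH unitary_matrix_mult) auto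
  ultimately show ?case using step.hyps(2,3) by (auto intro!: mean_le mean_ge)
qed

text \<open>By invariance of \<open>\<sigma>\<close>, the constant that the averages of \<open>F\<close> approach is the mean of \<open>F\<close> over the sphere. Hence the
integral of a good average against \<open>\<mu>\<close> is close to the total mass of \<open>\<mu>\<close> times this mean, while it
stays in every interval that contains the integrals of all translates of \<open>F\<close>.\<close>

lemma surface_mean_between:
  fixes F :: "complex^'d \<Rightarrow> real"
  assumes F: "continuous_on UNIV F" and \<mu>: "reinhardt_sphere_measure \<mu>"
    and b: "\<And>v. unitary_matrix v \<Longrightarrow> a \<le> (\<integral>z. F (v *v z) \<partial>\<mu>) \<and> (\<integral>z. F (v *v z) \<partial>\<mu>) \<le> b"
  shows "a \<le> measure \<mu> UNIV * (\<integral>z. F z \<partial>normalized_surface_measure)"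
    and "measure \<mu> UNIV * (\<integral>z. F z \<partial>normalized_surface_measure) \<le> b"
proof -
  let ?m = "measure \<mu> UNIV" and ?s = "\<integral>z. F z \<partial>normalized_surface_measure"
  have s1: "measure (normalized_surface_measure :: (complex^'d) measure) UNIV = 1"
    by (simp add: measure_def emeasure_surface_measure)
  have near: "a \<le> ?m * ?s + e \<and> ?m * ?s \<le> b + e" if e: "e > 0" for e
  proof -
    \<comment> \<open>Two errors of size \<open>d \<cdot> ?m\<close> occur below; the summand 1 covers total mass zero.\<close>
    define d where "d = e / (2 * ?m + 1)"
    have m: "?m \<ge> 0" by simp
    then have m1: "2 * ?m + 1 > 0" by linarith
    have d: "d > 0" unfolding d_def by (rule divide_pos_pos[OF e m1])
    have "2 * d * ?m = e * (2 * ?m / (2 * ?m + 1))" by (simp add: d_def)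
    also have "\<dots> \<le> e * 1" using e divide_le_eq_1_pos[OF m1, of "2 * ?m"] by (intro mult_left_mono) auto
    finally have d2: "2 * d * ?m \<le> e" by simp
    obtain g c where g: "unitary_average F g" and c: "\<And>z. norm z = 1 \<Longrightarrow> \<bar>g z - c\<bar> \<le> d"
      using averages_nearly_constant[OF F d] by blast
    note cg = unitary_average_continuous[OF g F]
    have "\<bar>?s - c\<bar> \<le> d"
      using integral_near_constant[OF reinhardt_surface_measure cg c]
      by (simp add: s1 unitary_average_integral_surface[OF g F])
    then have "\<bar>?s * ?m - c * ?m\<bar> \<le> d * ?m"
      using m by (simp add: left_diff_distrib[symmetric] abs_mult mult_right_mono)
    moreover have "\<bar>(\<integral>z. g z \<partial>\<mu>) - c * ?m\<bar> \<le> d * ?m"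
      by (rule integral_near_constant[OF \<mu> cg c])
    moreover have "a \<le> (\<integral>z. g z \<partial>\<mu>)" "(\<integral>z. g z \<partial>\<mu>) \<le> b"
      using unitary_average_integral_bounds[OF g F \<mu> b unitary_matrix_1] by simp_all
    ultimately show ?thesis using d2 unfolding mult.commute[of ?m ?s] by arith
  qed
  show "a \<le> ?m * ?s" by (rule field_le_epsilon) (use near in auto)
  show "?m * ?s \<le> b" by (rule field_le_epsilon) (use near in auto)
qed

section \<open>Uniform estimates for unitary substitutions\<close>

text \<open>For each bound \<open>N\<close> the unitary matrices that satisfy the estimate with \<open>N\<close> form a closed set, and these
sets exhaust the compact unitary group. By Baire, one of them contains a neighbourhood of some
\<open>u\<^sub>0\<close>. Finitely many translates of this neighbourhood cover the group, and a translate costs only the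
constant of the matrix \<open>w u\<^sub>0\<^sup>*\<close> that moves it, since substitutions preserve homogeneous polynomials.\<close>

lemma uniform_composition_bound:
  fixes \<mu> :: "(complex^'d) measure"
  assumes \<mu>: "reinhardt_sphere_measure \<mu>"
    and bound: "\<And>u. unitary_matrix u \<Longrightarrow>
      \<exists>C. \<forall>f n. (\<integral>z. (cmod (slice f (u *v z) n))\<^sup>2 \<partial>\<mu>) \<le> C * (\<integral>z. (cmod (slice f z n))\<^sup>2 \<partial>\<mu>)"
  obtains C where "C > 0" "\<And>u f n. unitary_matrix u \<Longrightarrow>
     (\<integral>z. (cmod (slice f (u *v z) n))\<^sup>2 \<partial>\<mu>) \<le> C * (\<integral>z. (cmod (slice f z n))\<^sup>2 \<partial>\<mu>)"
proof -
  define q where "q = (\<lambda>f n (u :: complex^'d^'d). \<integral>z. (cmod (slice f (u *v z) n))\<^sup>2 \<partial>\<mu>)"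
  have q1: "q f n (mat 1) = (\<integral>z. (cmod (slice f z n))\<^sup>2 \<partial>\<mu>)" for f n by (simp add: q_def)
  have q0: "q f n u \<ge> 0" for f n u unfolding q_def by simp
  have bound': "\<exists>C. \<forall>f n. q f n u \<le> C * q f n (mat 1)" if "unitary_matrix u" for u
    using bound[OF that] unfolding q_def by simp
  let ?U = "{u :: complex^'d^'d. unitary_matrix u}"
  let ?F = "\<lambda>N :: nat. {u \<in> ?U. \<forall>f n. q f n u \<le> real N * q f n (mat 1)}"
  have adj_cont [continuous_intros]: "continuous_on A (\<lambda>x. adjoint_matrix (h x))"
    if "continuous_on A h" for A and h :: "'x::topological_space \<Rightarrow> complex^'d^'d"
    unfolding adjoint_matrix_def by (intro continuous_intros that)
  have mult_cont [continuous_intros]: "continuous_on A (\<lambda>x. g x ** h x)"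
    if "continuous_on A g" "continuous_on A h" for A and g h :: "'x::topological_space \<Rightarrow> complex^'d^'d"
    unfolding matrix_matrix_mult_def by (intro continuous_intros that)
  have closedU: "closed ?U"
    unfolding unitary_matrix_iff by (intro closed_Collect_eq continuous_intros)
  \<comment> \<open>The operator norm dominates each entry: apply \<open>u\<close> to a basis vector.\<close>
  have entry: "cmod (u $ i $ j) \<le> 1" if "unitary_matrix u" for u :: "complex^'d^'d" and i j
  proof -
    have "cmod ((u *v axis j 1) $ i) \<le> norm (u *v axis j 1)" by (rule Finite_Cartesian_Product.norm_nth_le)
    also have "\<dots> = norm (axis j (1 :: complex) :: complex^'d)" by (rule norm_unitary[OF that])
    also have "\<dots> = 1"
      by (simp add: norm_vec_def L2_set_def axis_def if_distrib[where f = norm] if_distrib[where f = "\<lambda>x. x\<^sup>2"] cong: if_cong)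
    finally show ?thesis by (simp add: matrix_vector_mult_def axis_def if_distrib cong: if_cong)
  qed
  have "bounded ?U"
    unfolding bounded_iff
  proof (intro exI ballI)
    fix u assume "u \<in> ?U"
    then have "norm (u $ i) \<le> (\<Sum>j\<in>(UNIV :: 'd set). 1)" for i
      unfolding norm_vec_def[of "u $ i"] using entry[of u i]
      by (intro order_trans[OF L2_set_le_sum] sum_mono) auto
    then show "norm u \<le> (\<Sum>i\<in>(UNIV :: 'd set). \<Sum>j\<in>(UNIV :: 'd set). 1)"
      unfolding norm_vec_def[of u] by (intro order_trans[OF L2_set_le_sum] sum_mono) auto
  qed
  then have compactU: "compact ?U" using closedU by (simp add: compact_eq_bounded_closed)
  have q_lim: "(\<lambda>k. q f n (x k)) \<longlonglongrightarrow> q f n l"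
    if x: "\<And>k. unitary_matrix (x k)" "x \<longlonglongrightarrow> l" for x l f n
  proof -
    interpret finite_measure \<mu> by (rule reinhardt_facts[OF \<mu>])
    have [measurable_cong]: "sets \<mu> = sets borel" by (rule reinhardt_facts[OF \<mu>])
    have "compact ((\<lambda>z. slice f z n) ` sphere 0 1)"
      by (intro compact_continuous_image continuous_intros) auto
    then obtain B where B: "\<And>z. norm z = 1 \<Longrightarrow> cmod (slice f z n) \<le> B"
      by (fastforce dest!: compact_imp_bounded simp: bounded_iff)
    show ?thesis
      unfolding q_def
    proof (rule integral_dominated_convergence[where w = "\<lambda>_. B\<^sup>2"])
      show "AE z in \<mu>. (\<lambda>k. (cmod (slice f (x k *v z) n))\<^sup>2) \<longlonglongrightarrow> (cmod (slice f (l *v z) n))\<^sup>2"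
      proof (rule AE_I2)
        fix z :: "complex^'d"
        have "continuous_on UNIV (\<lambda>u. (cmod (slice f (u *v z) n))\<^sup>2)" by (intro continuous_intros)
        then have "isCont (\<lambda>u. (cmod (slice f (u *v z) n))\<^sup>2) l" by (simp add: continuous_on_eq_continuous_at)
        from isCont_tendsto_compose[OF this x(2)]
        show "(\<lambda>k. (cmod (slice f (x k *v z) n))\<^sup>2) \<longlonglongrightarrow> (cmod (slice f (l *v z) n))\<^sup>2" .
      qed
      show "AE z in \<mu>. norm ((cmod (slice f (x k *v z) n))\<^sup>2) \<le> B\<^sup>2" for k
        using reinhardt_facts(4)[OF \<mu>]
      proof eventually_elim
        case (elim z)
        then have "cmod (slice f (x k *v z) n) \<le> B" by (intro B) (simp add: norm_unitary[OF x(1)])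
        then show ?case by (simp add: power_mono)
      qed
    qed auto
  qed
  have closedF: "closed (?F N)" for N
  proof (unfold closed_sequential_limits, intro allI impI, elim conjE)
    fix x l assume x: "\<forall>k. x k \<in> ?F N" "x \<longlonglongrightarrow> l"
    then have "l \<in> ?U" using closedU unfolding closed_sequential_limits by blast
    moreover have "q f n l \<le> real N * q f n (mat 1)" for f n
      by (rule Lim_bounded[OF q_lim[of x l f n], of 0]) (use x in auto)
    ultimately show "l \<in> ?F N" by blast
  qed
  have cover: "\<exists>N. u \<in> ?F N" if u: "u \<in> ?U" for u
  proof -
    obtain C where C: "\<And>f n. q f n u \<le> C * q f n (mat 1)" using bound' u by blast
    obtain N :: nat where N: "C \<le> real N" using real_arch_simple by blast
    have "q f n u \<le> real N * q f n (mat 1)" for f n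
      using C[of f n] mult_right_mono[OF N q0[of f n "mat 1"]] by linarith
    then show ?thesis using u by blast
  qed
  have "\<exists>N. \<not> ?U \<subseteq> closure (?U - ?F N)"
  proof (rule ccontr)
    assume "\<not> ?thesis"
    then have dense: "\<And>N. ?U \<subseteq> closure (?U - ?F N)" by blast
    have "?U \<subseteq> closure (\<Inter> (range (\<lambda>N. ?U - ?F N)))"
    proof (rule Baire[OF closedU])
      fix T assume "T \<in> range (\<lambda>N. ?U - ?F N)"
      then obtain N where T: "T = ?U - ?F N" by blast
      have "T = ?U \<inter> - ?F N" unfolding T by blast
      then have "openin (top_of_set ?U) T" using closedF[of N] by (auto simp: openin_open)
      then show "openin (top_of_set ?U) T \<and> ?U \<subseteq> closure T" using dense T by blast
    qed simp
    moreover have empty: "\<Inter> (range (\<lambda>N. ?U - ?F N)) = {}" using cover by blast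
    ultimately have "?U \<subseteq> {}" by (simp only: empty closure_empty)
    then show False using unitary_matrix_1 by blast
  qed
  then obtain N u0 where u0: "unitary_matrix u0" "u0 \<notin> closure (?U - ?F N)" by blast
  \<comment> \<open>The complement of \<open>D\<close> is a neighbourhood of \<open>u\<^sub>0\<close> in which all unitary matrices obey the bound \<open>N\<close>; \<open>V w\<close> is its translate around \<open>w\<close>.\<close>
  define D where "D = closure (?U - ?F N)"
  define V where "V = (\<lambda>w. (\<lambda>u. u0 ** (adjoint_matrix w ** u)) -` (- D))"
  have openV: "open (V w)" for w
    unfolding V_def D_def by (intro open_vimage continuous_intros) auto
  have wV: "w \<in> V w" if "unitary_matrix w" for w
    using u0(2) that by (simp add: V_def D_def unitary_adjoint del: closure_closed)
  obtain W where W: "W \<subseteq> ?U" "finite W" "?U \<subseteq> (\<Union>w\<in>W. V w)"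
  proof (rule compactE_image[OF compactU])
    show "open (V w)" for w by (rule openV)
    show "?U \<subseteq> (\<Union>w\<in>?U. V w)" using wV by blast
  qed
  have "\<forall>w\<in>W. \<exists>C. \<forall>f n. q f n (w ** adjoint_matrix u0) \<le> C * q f n (mat 1)"
    using W(1) u0(1) by (intro ballI bound' unitary_matrix_mult unitary_matrix_adjoint) auto
  then obtain c where c: "\<And>w f n. w \<in> W \<Longrightarrow> q f n (w ** adjoint_matrix u0) \<le> c w * q f n (mat 1)"
    by metis
  define C where "C = 1 + real N * (\<Sum>w\<in>W. \<bar>c w\<bar>)"
  show thesis
  proof (rule that)
    show "C > 0" unfolding C_def by (intro add_pos_nonneg mult_nonneg_nonneg sum_nonneg) auto
    fix u :: "complex^'d^'d" and f n assume u: "unitary_matrix u"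
    then obtain w where w: "w \<in> W" "u \<in> V w" using W(3) by blast
    let ?v = "u0 ** (adjoint_matrix w ** u)"
    have uw: "unitary_matrix w" using w(1) W(1) by blast
    have "unitary_matrix ?v" by (intro unitary_matrix_mult unitary_matrix_adjoint u u0 uw)
    then have v: "?v \<in> ?F N" using w(2) closure_subset[of "?U - ?F N"] unfolding V_def D_def by blast
    have ueq: "u *v z = (w ** adjoint_matrix u0) *v (?v *v z)" for z
      by (simp add: matrix_vector_mul_assoc[symmetric] unitary_cancel[OF u0(1)] unitary_cancel[OF uw])
    obtain g where g: "\<And>z m. slice g z m = slice f ((w ** adjoint_matrix u0) *v z) m"
      using ex_slice_matrix[of f "w ** adjoint_matrix u0"] by blast
    have "q f n u = q g n ?v" unfolding q_def ueq g ..
    also have "\<dots> \<le> real N * q g n (mat 1)" using v by blast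
    also have "q g n (mat 1) = q f n (w ** adjoint_matrix u0)" unfolding q_def g by simp
    also have "real N * \<dots> \<le> real N * (c w * q f n (mat 1))"
      using c[OF w(1), of f n] by (intro mult_left_mono) auto
    also have "\<dots> = (real N * c w) * q f n (mat 1)" by simp
    also have "\<dots> \<le> C * q f n (mat 1)"
    proof (rule mult_right_mono[OF _ q0])
      have "c w \<le> (\<Sum>w\<in>W. \<bar>c w\<bar>)"
        using member_le_sum[OF w(1) _ W(2), of "\<lambda>w. \<bar>c w\<bar>"] by simp
      then have "real N * c w \<le> real N * (\<Sum>w\<in>W. \<bar>c w\<bar>)" by (rule mult_left_mono) simp
      then show "real N * c w \<le> C" by (simp add: C_def)
    qed
    finally show "(\<integral>z. (cmod (slice f (u *v z) n))\<^sup>2 \<partial>\<mu>) \<le> C * (\<integral>z. (cmod (slice f z n))\<^sup>2 \<partial>\<mu>)"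
      unfolding q1 by (simp add: q_def)
  qed
qed

section \<open>Bounded operators between weighted spaces\<close>

lemma H2_add:
  assumes "f \<in> H2 w" "g \<in> H2 w" shows "(\<lambda>i. f i + g i) \<in> H2 w"
proof -
  have sq: "(cmod (a + b))\<^sup>2 \<le> 2 * (cmod a)\<^sup>2 + 2 * (cmod b)\<^sup>2" for a b :: complex
  proof -
    have "(cmod (a + b))\<^sup>2 \<le> (cmod a + cmod b)\<^sup>2" by (intro power_mono norm_triangle_ineq) simp
    also have "\<dots> \<le> 2 * (cmod a)\<^sup>2 + 2 * (cmod b)\<^sup>2"
      using sum_squares_bound[of "cmod a" "cmod b"] by (simp add: power2_sum)
    finally show ?thesis .
  qed
  have "(\<lambda>i. 2 * ((cmod (f i))\<^sup>2 * (w i)\<^sup>2) + 2 * ((cmod (g i))\<^sup>2 * (w i)\<^sup>2)) summable_on UNIV"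
    using assms unfolding H2_def by (intro summable_on_add summable_on_cmult_right) auto
  then have "(\<lambda>i. (cmod (f i + g i))\<^sup>2 * (w i)\<^sup>2) summable_on UNIV"
  proof (rule summable_on_comparison_test)
    fix i
    show "(cmod (f i + g i))\<^sup>2 * (w i)\<^sup>2 \<le> 2 * ((cmod (f i))\<^sup>2 * (w i)\<^sup>2) + 2 * ((cmod (g i))\<^sup>2 * (w i)\<^sup>2)"
      using mult_right_mono[OF sq[of "f i" "g i"], of "(w i)\<^sup>2"] by (simp add: algebra_simps)
  qed auto
  then show ?thesis by (simp add: H2_def)
qed

lemma H2_scale: "f \<in> H2 w \<Longrightarrow> (\<lambda>i. c * f i) \<in> H2 w"
  by (auto simp: H2_def norm_mult power_mult_distrib mult.assoc intro: summable_on_cmult_right)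

lemma H2_zero: "(\<lambda>i. 0) \<in> H2 w"
  by (simp add: H2_def)

lemma H2_sum:
  assumes "finite K" "\<And>k. k \<in> K \<Longrightarrow> f k \<in> H2 w"
  shows "(\<lambda>i. \<Sum>k\<in>K. c k * f k i) \<in> H2 w"
  using assms
proof induction
  case empty
  then show ?case by (simp add: H2_zero)
next
  case (insert k K)
  have "(\<lambda>i. c k * f k i + (\<Sum>k\<in>K. c k * f k i)) \<in> H2 w"
    using insert by (intro H2_add H2_scale) auto
  then show ?case using insert.hyps by simp
qed

lemma bounded_operator_add:
  assumes "bounded_operator w v S" "f \<in> H2 w" "g \<in> H2 w"
  shows "S (\<lambda>i. f i + g i) = (\<lambda>k. S f k + S g k)"
  using assms unfolding bounded_operator_def by blast

lemma bounded_operator_scale: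
  assumes "bounded_operator w v S" "f \<in> H2 w"
  shows "S (\<lambda>i. c * f i) = (\<lambda>k. c * S f k)"
  using assms unfolding bounded_operator_def by blast

lemma bounded_operator_sum:
  assumes S: "bounded_operator w v S" and "finite K" "\<And>k. k \<in> K \<Longrightarrow> f k \<in> H2 w"
  shows "S (\<lambda>i. \<Sum>k\<in>K. c k * f k i) = (\<lambda>i. \<Sum>k\<in>K. c k * S (f k) i)"
proof -
  note add = bounded_operator_add[OF S] and scale = bounded_operator_scale[OF S]
  from assms(2,3) show ?thesis
  proof induction
    case empty
    show ?case using scale[OF H2_zero, of 0] by simp
  next
    case (insert k K)
    have "S (\<lambda>i. c k * f k i + (\<Sum>k\<in>K. c k * f k i)) = (\<lambda>i. c k * S (f k) i + S (\<lambda>i. \<Sum>k\<in>K. c k * f k i) i)"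
      using insert by (subst add) (auto intro!: H2_scale H2_sum simp: scale)
    then show ?case using insert by simp
  qed
qed

lemma bounded_operatorD:
  assumes "bounded_operator w v S"
  shows "f \<in> H2 w \<Longrightarrow> S f \<in> H2 v" "\<exists>C\<ge>0. \<forall>f\<in>H2 w. H2_norm v (S f) \<le> C * H2_norm w f"
proof -
  show "f \<in> H2 w \<Longrightarrow> S f \<in> H2 v" using assms by (auto simp: bounded_operator_def)
  obtain C where C: "\<forall>f\<in>H2 w. H2_norm v (S f) \<le> C * H2_norm w f" using assms by (auto simp: bounded_operator_def)
  have "H2_norm v (S f) \<le> max C 0 * H2_norm w f" if "f \<in> H2 w" for f
    using C that mult_right_mono[of C "max C 0" "H2_norm w f"] by fastforce
  then show "\<exists>C\<ge>0. \<forall>f\<in>H2 w. H2_norm v (S f) \<le> C * H2_norm w f" by (intro exI[of _ "max C 0"]) auto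
qed

lemma bounded_operator_compose:
  assumes S: "bounded_operator w v S" and T: "bounded_operator v x T"
  shows "bounded_operator w x (\<lambda>f. T (S f))"
proof -
  obtain C where C: "\<And>f. f \<in> H2 w \<Longrightarrow> H2_norm v (S f) \<le> C * H2_norm w f" using bounded_operatorD(2)[OF S] by blast
  obtain D where D: "D \<ge> 0" "\<And>f. f \<in> H2 v \<Longrightarrow> H2_norm x (T f) \<le> D * H2_norm v f" using bounded_operatorD(2)[OF T] by blast
  have "H2_norm x (T (S f)) \<le> (D * C) * H2_norm w f" if "f \<in> H2 w" for f
    using D(2)[OF bounded_operatorD(1)[OF S that]] mult_left_mono[OF C[OF that] D(1)] by (simp add: mult.assoc)
  moreover have "\<forall>f\<in>H2 w. S f \<in> H2 v" using S by (auto simp: bounded_operator_def)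
  ultimately show ?thesis using S T unfolding bounded_operator_def by auto
qed

text \<open>Comparable weights define the same space with equivalent norms.\<close>

lemma bounded_operator_id:
  assumes K: "0 \<le> K" and le: "\<And>i. (v i)\<^sup>2 \<le> K * (w i)\<^sup>2"
  shows "bounded_operator w v (\<lambda>f. f)"
proof -
  have *: "H2_sq v f \<le> ennreal ((sqrt K)\<^sup>2) * H2_sq w f" for f
  proof -
    have "H2_sq v f \<le> (\<integral>\<^sup>+ i. ennreal ((sqrt K)\<^sup>2) * ennreal ((cmod (f i))\<^sup>2 * (w i)\<^sup>2) \<partial>count_space UNIV)"
      unfolding H2_sq_def
    proof (rule nn_integral_mono)
      fix i
      have "(cmod (f i))\<^sup>2 * (v i)\<^sup>2 \<le> (cmod (f i))\<^sup>2 * (K * (w i)\<^sup>2)" by (intro mult_left_mono le) simp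
      then show "ennreal ((cmod (f i))\<^sup>2 * (v i)\<^sup>2) \<le> ennreal ((sqrt K)\<^sup>2) * ennreal ((cmod (f i))\<^sup>2 * (w i)\<^sup>2)"
        using K by (simp add: ennreal_mult[symmetric] ennreal_leI mult.left_commute)
    qed
    then show ?thesis by (simp add: H2_sq_def nn_integral_cmult)
  qed
  then show ?thesis
    unfolding bounded_operator_def using H2_sq_mono_bound[OF *, of _] K
    by (auto intro!: exI[of _ "sqrt K"])
qed

lemma H2_sq_degree_ge:
  fixes \<mu> :: "(complex^'d) measure"
  assumes \<mu>: "reinhardt_sphere_measure \<mu>" and w: "\<And>\<alpha>. (w \<alpha>)\<^sup>2 = (\<gamma> (mdeg \<alpha>))\<^sup>2 * moment \<mu> \<alpha>"
  shows "ennreal ((\<gamma> n)\<^sup>2 * (\<integral>z. (cmod (slice f z n))\<^sup>2 \<partial>\<mu>)) \<le> H2_sq w f"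
proof -
  have "(\<gamma> n)\<^sup>2 * (\<integral>z. (cmod (slice f z n))\<^sup>2 \<partial>\<mu>) = (\<Sum>\<alpha> | mdeg \<alpha> = n. (cmod (f \<alpha>))\<^sup>2 * (w \<alpha>)\<^sup>2)"
    unfolding integral_slice_sq[OF \<mu>] sum_distrib_left by (intro sum.cong) (auto simp: w)
  then show ?thesis
    unfolding H2_sq_by_degree
    using sum_le_suminf[of "\<lambda>n. ennreal (\<Sum>\<alpha> | mdeg \<alpha> = n. (cmod (f \<alpha>))\<^sup>2 * (w \<alpha>)\<^sup>2)" "{n}"] by simp
qed

lemma H2_sq_homogeneous:
  fixes \<mu> :: "(complex^'d) measure"
  assumes \<mu>: "reinhardt_sphere_measure \<mu>" and w: "\<And>\<alpha>. (w \<alpha>)\<^sup>2 = (\<gamma> (mdeg \<alpha>))\<^sup>2 * moment \<mu> \<alpha>"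
    and f: "\<And>\<alpha>. mdeg \<alpha> \<noteq> n \<Longrightarrow> f \<alpha> = 0"
  shows "H2_sq w f = ennreal ((\<gamma> n)\<^sup>2 * (\<integral>z. (cmod (slice f z n))\<^sup>2 \<partial>\<mu>))"
proof -
  have eq: "(\<gamma> n)\<^sup>2 * (\<integral>z. (cmod (slice f z n))\<^sup>2 \<partial>\<mu>) = (\<Sum>\<alpha> | mdeg \<alpha> = n. (cmod (f \<alpha>))\<^sup>2 * (w \<alpha>)\<^sup>2)"
    unfolding integral_slice_sq[OF \<mu>] sum_distrib_left by (intro sum.cong) (auto simp: w)
  have "H2_sq w f = (\<Sum>\<alpha> | mdeg \<alpha> = n. ennreal ((cmod (f \<alpha>))\<^sup>2 * (w \<alpha>)\<^sup>2))"
    unfolding H2_sq_def using f by (intro nn_integral_count_space') auto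
  then show ?thesis unfolding eq by (simp add: sum_ennreal)
qed

section \<open>Unitary substitution on the space over the surface measure\<close>

text \<open>Positive moments make the integral norm of a homogeneous component control every coefficient,
so a series is determined by its slices.\<close>

lemma slice_inj:
  fixes \<mu> :: "(complex^'d) measure" and f g :: "('d \<Rightarrow> nat) \<Rightarrow> complex"
  assumes \<mu>: "reinhardt_sphere_measure \<mu>" and pos: "\<And>\<alpha>. moment \<mu> \<alpha> > 0"
    and eq: "\<And>z n. slice f z n = slice g z n"
  shows "f = g"
proof
  fix \<alpha> :: "'d \<Rightarrow> nat"
  let ?h = "\<lambda>i. f i + (-1) * g i"
  have "slice ?h z n = 0" for z n unfolding slice_add slice_mult eq by simp
  then have "(\<Sum>\<kappa> | mdeg \<kappa> = mdeg \<alpha>. (cmod (?h \<kappa>))\<^sup>2 * moment \<mu> \<kappa>) = 0"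
    unfolding integral_slice_sq[OF \<mu>, symmetric] by simp
  then have "(cmod (?h \<alpha>))\<^sup>2 * moment \<mu> \<alpha> = 0"
    by (subst (asm) sum_nonneg_eq_0_iff) auto
  then show "f \<alpha> = g \<alpha>" using pos[of \<alpha>] by simp
qed

text \<open>The series \<open>f(uz)\<close>. Only the values of its slices matter, and they determine it whenever the monomials have
positive norm; hence a choice instead of an explicit formula for the coefficients.\<close>

definition compose_matrix :: "complex^'d^'d \<Rightarrow> (('d::finite \<Rightarrow> nat) \<Rightarrow> complex) \<Rightarrow> (('d \<Rightarrow> nat) \<Rightarrow> complex)" where
  "compose_matrix u f = (SOME g. \<forall>z n. slice g z n = slice f (u *v z) n)"

lemma slice_compose_matrix: "slice (compose_matrix u f) z n = slice f (u *v z) n"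
  using someI_ex[OF ex_slice_matrix[of f u]] unfolding compose_matrix_def by blast

lemma compose_matrix_intertwines:
  fixes \<mu> :: "(complex^'d) measure" and u :: "complex^'d^'d"
  assumes \<mu>: "reinhardt_sphere_measure \<mu>" and pos: "\<And>\<alpha>. moment \<mu> \<alpha> > 0"
  shows "compose_matrix u (Mz j f) = unitary_action u Mz j (compose_matrix u f)"
proof (rule slice_inj[OF \<mu> pos])
  fix z n
  show "slice (compose_matrix u (Mz j f)) z n = slice (unitary_action u Mz j (compose_matrix u f)) z n"
    by (cases n) (simp_all add: slice_compose_matrix slice_unitary_action_0 slice_unitary_action_Suc
        slice_Mz_0 slice_Mz_Suc)
qed

text \<open>Substituting \<open>uz\<close> is an isometry: by the norm identity it only changes the variable of integration, and the
surface measure is unitarily invariant.\<close>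

lemma compose_matrix_bounded_invertible:
  fixes u :: "complex^'d^'d"
  assumes u: "unitary_matrix u"
    and w: "\<And>\<alpha>. (w \<alpha>)\<^sup>2 = (\<gamma> (mdeg \<alpha>))\<^sup>2 * moment normalized_surface_measure \<alpha>"
    and pos: "\<And>\<alpha>. moment (normalized_surface_measure :: (complex^'d) measure) \<alpha> > 0"
  shows "bounded_invertible_operator w w (compose_matrix u)"
proof -
  let ?\<sigma> = "normalized_surface_measure :: (complex^'d) measure"
  note inj = slice_inj[OF reinhardt_surface_measure pos]
  have sq: "H2_sq w (compose_matrix v f) = H2_sq w f" if v: "unitary_matrix v" for v f
  proof -
    have m: "(\<lambda>z. v *v z) \<in> ?\<sigma> \<rightarrow>\<^sub>M borel"
      unfolding measurable_cong_sets[OF reinhardt_facts(2)[OF reinhardt_surface_measure] refl] by measurable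
    have "H2_sq w (compose_matrix v f) = (\<integral>\<^sup>+ z. H2_sq \<gamma> (slice (compose_matrix v f) z) \<partial>?\<sigma>)"
      by (rule slice_norm_identity[OF reinhardt_surface_measure w, symmetric])
    also have "\<dots> = (\<integral>\<^sup>+ z. H2_sq \<gamma> (slice f (v *v z)) \<partial>?\<sigma>)"
      unfolding H2_sq_nat slice_compose_matrix ..
    also have "\<dots> = (\<integral>\<^sup>+ z. H2_sq \<gamma> (slice f z) \<partial>distr ?\<sigma> borel (\<lambda>z. v *v z))"
      by (rule nn_integral_distr[OF m, symmetric]) measurable
    also have "\<dots> = H2_sq w f"
      unfolding surface_measure_unitary[OF v] by (rule slice_norm_identity[OF reinhardt_surface_measure w])
    finally show ?thesis .
  qed
  have bd: "bounded_operator w w (compose_matrix v)" if v: "unitary_matrix v" for v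
    unfolding bounded_operator_def
  proof (intro conjI ballI allI exI[of _ 1])
    fix f g assume f: "f \<in> H2 w" and g: "g \<in> H2 w"
    show "compose_matrix v (\<lambda>i. f i + g i) = (\<lambda>k. compose_matrix v f k + compose_matrix v g k)"
      by (rule inj) (simp add: slice_compose_matrix slice_add)
  next
    fix f c
    show "compose_matrix v (\<lambda>i. c * f i) = (\<lambda>k. c * compose_matrix v f k)"
      by (rule inj) (simp add: slice_compose_matrix slice_mult)
  next
    fix f assume f: "f \<in> H2 w"
    have le: "H2_sq w (compose_matrix v f) \<le> ennreal (1\<^sup>2) * H2_sq w f" by (simp add: sq[OF v])
    show "compose_matrix v f \<in> H2 w" "H2_norm w (compose_matrix v f) \<le> 1 * H2_norm w f"
      by (rule H2_sq_mono_bound[OF le f], simp)+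
  qed
  show ?thesis
    unfolding bounded_invertible_operator_def
  proof (intro conjI exI[of _ "compose_matrix (adjoint_matrix u)"] ballI)
    fix f
    show "compose_matrix (adjoint_matrix u) (compose_matrix u f) = f"
      by (rule inj) (simp add: slice_compose_matrix unitary_cancel[OF u])
    show "compose_matrix u (compose_matrix (adjoint_matrix u) f) = f"
      by (rule inj) (simp add: slice_compose_matrix unitary_cancel[OF u])
  qed (use bd u unitary_matrix_adjoint in auto)
qed

section \<open>Intertwiners and the comparison of moments\<close>

lemma H2_tail_small:
  assumes f: "f \<in> H2 w" and e: "e > 0"
  obtains A where "finite A" "(\<lambda>i. if i \<in> A then 0 else f i) \<in> H2 w"
    "H2_norm w (\<lambda>i. if i \<in> A then 0 else f i) \<le> e"
proof -
  let ?a = "\<lambda>i. (cmod (f i))\<^sup>2 * (w i)\<^sup>2"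
  have sm: "?a summable_on UNIV" using f by (simp add: H2_def)
  then have "(?a has_sum infsum ?a UNIV) UNIV" by (rule has_sum_infsum)
  then have "\<forall>\<^sub>F A in finite_subsets_at_top UNIV. dist (sum ?a A) (infsum ?a UNIV) < e\<^sup>2"
    unfolding has_sum_def by (rule tendstoD) (use e in simp)
  then obtain A where A: "finite A" "dist (sum ?a A) (infsum ?a UNIV) < e\<^sup>2"
    unfolding eventually_finite_subsets_at_top by auto
  let ?t = "\<lambda>i. if i \<in> A then 0 else f i"
  have smc: "?a summable_on (- A)" using sm by (rule summable_on_subset_banach) auto
  have cong: "(\<lambda>i. (cmod (?t i))\<^sup>2 * (w i)\<^sup>2) summable_on UNIV \<longleftrightarrow> ?a summable_on (- A)"
    by (rule summable_on_cong_neutral) auto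
  then have t: "?t \<in> H2 w" using smc by (simp add: H2_def)
  have "(H2_norm w ?t)\<^sup>2 = infsum ?a (- A)"
    unfolding H2_norm_sq by (rule infsum_cong_neutral) auto
  also have "\<dots> = infsum ?a UNIV - sum ?a A"
  proof -
    have "infsum ?a (A \<union> - A) = infsum ?a A + infsum ?a (- A)"
      by (rule infsum_Un_disjoint) (use A(1) smc in auto)
    then show ?thesis using A(1) by (simp add: Compl_partition)
  qed
  also have "\<dots> \<le> e\<^sup>2" using A(2) by (simp add: dist_real_def abs_less_iff)
  finally have "H2_norm w ?t \<le> e" by (rule power2_le_imp_le) (use e in simp)
  then show thesis using that A(1) t by blast
qed

lemma coeff_le_H2_norm:
  assumes "f \<in> H2 w" shows "cmod (f i) * \<bar>w i\<bar> \<le> H2_norm w f"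
proof -
  have "(cmod (f i))\<^sup>2 * (w i)\<^sup>2 = infsum (\<lambda>i. (cmod (f i))\<^sup>2 * (w i)\<^sup>2) {i}" by simp
  also have "\<dots> \<le> (H2_norm w f)\<^sup>2"
    unfolding H2_norm_sq using assms by (intro infsum_mono2) (auto simp: H2_def)
  finally have "(cmod (f i) * \<bar>w i\<bar>)\<^sup>2 \<le> (H2_norm w f)\<^sup>2" by (simp add: power_mult_distrib)
  then show ?thesis by (rule power2_le_imp_le) simp
qed

text \<open>An intertwiner is determined by the series \<open>h = \<Gamma> 1\<close>: it sends \<open>z\<^sup>\<alpha>\<close> to \<open>(uz)\<^sup>\<alpha> h\<close>. The slice of degree \<open>n\<close> sees the
part of \<open>h\<close> of degree \<open>n - |\<alpha>|\<close>.\<close>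

lemma intertwiner_on_monomials:
  assumes inter: "\<And>j f. f \<in> H2 w \<Longrightarrow> \<Gamma> (Mz j f) = unitary_action u Mz j (\<Gamma> f)"
  shows "slice (\<Gamma> (single \<alpha>)) z n =
    (if n < mdeg \<alpha> then 0 else zpow (u *v z) \<alpha> * slice (\<Gamma> (single (\<lambda>_. 0))) z (n - mdeg \<alpha>))"
proof (induction "mdeg \<alpha>" arbitrary: \<alpha> n)
  case 0
  then have "\<alpha> = (\<lambda>_. 0)" using mdeg_zero_iff[of \<alpha>] by simp
  then show ?case by (simp add: mdeg_def)
next
  case (Suc m)
  then obtain j \<alpha>' where a: "\<alpha> = add_eps j \<alpha>'" "mdeg \<alpha>' = m" by (metis mdeg_Suc_cases)
  have "\<Gamma> (single \<alpha>) = unitary_action u Mz j (\<Gamma> (single \<alpha>'))"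
    unfolding a(1) Mz_single[symmetric] by (rule inter[OF single_in_H2])
  then show ?case
    using Suc.hyps(1)[of \<alpha>'] a
    by (cases n) (auto simp: slice_unitary_action_0 slice_unitary_action_Suc zpow_add_eps mult.assoc)
qed

lemma slice_0: "slice f z 0 = f (\<lambda>_. 0)"
proof -
  have "{\<alpha> :: 'a \<Rightarrow> nat. mdeg \<alpha> = 0} = {\<lambda>_. 0}" using mdeg_zero_iff by auto
  then show ?thesis by (simp add: slice_eq)
qed

lemma finite_support_expansion:
  assumes "finite A" shows "(\<lambda>i. if i \<in> A then f i else 0) = (\<lambda>i. \<Sum>\<alpha>\<in>A. f \<alpha> * single \<alpha> i)"
proof
  fix i
  have "(\<Sum>\<alpha>\<in>A. f \<alpha> * single \<alpha> i) = (\<Sum>\<alpha>\<in>A. if i = \<alpha> then f \<alpha> else 0)"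
    by (intro sum.cong) (auto simp: single_def)
  then show "(if i \<in> A then f i else 0) = (\<Sum>\<alpha>\<in>A. f \<alpha> * single \<alpha> i)" using assms by simp
qed

text \<open>If \<open>h = \<Gamma> 1\<close> had no constant term, neither would the image \<open>p(uz) h\<close> of any polynomial, nor, by density of
the polynomials and continuity of the constant term, any image at all. Then \<open>1\<close> would not be in the range.\<close>

lemma intertwiner_constant_term:
  fixes \<Gamma> :: "(('d::finite \<Rightarrow> nat) \<Rightarrow> complex) \<Rightarrow> (('d \<Rightarrow> nat) \<Rightarrow> complex)"
  assumes bd: "bounded_invertible_operator w w \<Gamma>" and w0: "w (\<lambda>_. 0) > 0"
    and inter: "\<And>j f. f \<in> H2 w \<Longrightarrow> \<Gamma> (Mz j f) = unitary_action u Mz j (\<Gamma> f)"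
  shows "\<Gamma> (single (\<lambda>_. 0)) (\<lambda>_. 0) \<noteq> 0"
proof
  let ?o = "\<lambda>_ :: 'd. 0 :: nat"
  assume h0: "\<Gamma> (single ?o) ?o = 0"
  have \<Gamma>: "bounded_operator w w \<Gamma>" using bd by (simp add: bounded_invertible_operator_def)
  have mon: "\<Gamma> (single \<alpha>) ?o = 0" for \<alpha>
    using intertwiner_on_monomials[of w \<Gamma> u \<alpha> 0 0, OF inter] h0 mdeg_zero_iff[of \<alpha>]
    by (auto simp: slice_0 split: if_splits)
  obtain R where "bounded_operator w w R" "\<forall>g\<in>H2 w. \<Gamma> (R g) = g"
    using bd unfolding bounded_invertible_operator_def by blast
  then obtain f where f: "f \<in> H2 w" "\<Gamma> f = single ?o"
    using single_in_H2[of ?o w] bounded_operatorD(1) by metis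
  obtain C where C: "C \<ge> 0" "\<And>f. f \<in> H2 w \<Longrightarrow> H2_norm w (\<Gamma> f) \<le> C * H2_norm w f"
    using bounded_operatorD(2)[OF \<Gamma>] by blast
  \<comment> \<open>Small enough that \<open>C \<cdot> e\<close> stays below the norm of a series with constant term 1.\<close>
  define e where "e = w ?o / (2 * (C + 1))"
  have e: "e > 0" using w0 C(1) by (simp add: e_def)
  obtain A where A: "finite A" "(\<lambda>i. if i \<in> A then 0 else f i) \<in> H2 w"
    "H2_norm w (\<lambda>i. if i \<in> A then 0 else f i) \<le> e" using H2_tail_small[OF f(1) e] by blast
  let ?t = "\<lambda>i. if i \<in> A then 0 else f i" and ?p = "\<lambda>i. if i \<in> A then f i else 0"
  have p: "?p \<in> H2 w" and \<Gamma>p: "\<Gamma> ?p ?o = 0"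
    unfolding finite_support_expansion[OF A(1)]
    by (auto simp: bounded_operator_sum[OF \<Gamma> A(1) single_in_H2] mon intro!: H2_sum single_in_H2 A(1))
  have "f = (\<lambda>i. ?p i + ?t i)" by auto
  then have "\<Gamma> f = \<Gamma> (\<lambda>i. ?p i + ?t i)" by (rule arg_cong)
  also have "\<dots> = (\<lambda>k. \<Gamma> ?p k + \<Gamma> ?t k)" by (rule bounded_operator_add[OF \<Gamma> p A(2)])
  finally have "\<Gamma> f ?o = \<Gamma> ?p ?o + \<Gamma> ?t ?o" by (rule fun_cong)
  then have "\<Gamma> ?t ?o = 1" unfolding f(2) \<Gamma>p by (simp add: single_def)
  then have "w ?o \<le> H2_norm w (\<Gamma> ?t)"
    using coeff_le_H2_norm[OF bounded_operatorD(1)[OF \<Gamma> A(2)], of ?o] w0 by simp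
  also have "\<dots> \<le> C * H2_norm w ?t" by (rule C(2)[OF A(2)])
  also have "\<dots> \<le> C * e" by (rule mult_left_mono[OF A(3) C(1)])
  also have "\<dots> < w ?o" using w0 C(1) by (simp add: e_def field_simps add_nonneg_pos)
  finally show False by simp
qed

text \<open>For \<open>p\<close> homogeneous of degree \<open>n\<close>, the lowest component of \<open>\<Gamma> p = p(uz) h\<close> is \<open>h(0) p(uz)\<close>, again
of degree \<open>n\<close>. The boundedness of \<open>\<Gamma>\<close> thus bounds \<open>p(uz)\<close>, and as both sides live in the same degree the factor
\<open>\<gamma>\<^sub>n\<close> cancels. So the constant depends on neither \<open>n\<close> nor \<open>p\<close>.\<close>

lemma composition_bound:
  fixes \<mu> :: "(complex^'d) measure"
  assumes \<mu>: "reinhardt_sphere_measure \<mu>" and w: "\<And>\<alpha>. (w \<alpha>)\<^sup>2 = (\<gamma> (mdeg \<alpha>))\<^sup>2 * moment \<mu> \<alpha>"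
    and pos: "\<And>\<alpha>. w \<alpha> > 0" "\<And>n. \<gamma> n > 0"
    and bd: "bounded_invertible_operator w w \<Gamma>"
    and inter: "\<And>j f. f \<in> H2 w \<Longrightarrow> \<Gamma> (Mz j f) = unitary_action u Mz j (\<Gamma> f)"
  shows "\<exists>C. \<forall>f n. (\<integral>z. (cmod (slice f (u *v z) n))\<^sup>2 \<partial>\<mu>) \<le> C * (\<integral>z. (cmod (slice f z n))\<^sup>2 \<partial>\<mu>)"
proof -
  define h0 where "h0 = \<Gamma> (single (\<lambda>_. 0)) (\<lambda>_. 0)"
  have h0: "h0 \<noteq> 0" unfolding h0_def by (rule intertwiner_constant_term[OF bd pos(1) inter])
  have \<Gamma>: "bounded_operator w w \<Gamma>" using bd by (simp add: bounded_invertible_operator_def)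
  obtain C where C: "C \<ge> 0" "\<And>f. f \<in> H2 w \<Longrightarrow> H2_norm w (\<Gamma> f) \<le> C * H2_norm w f"
    using bounded_operatorD(2)[OF \<Gamma>] by blast
  have "(\<integral>z. (cmod (slice f (u *v z) n))\<^sup>2 \<partial>\<mu>) \<le> (C / cmod h0)\<^sup>2 * (\<integral>z. (cmod (slice f z n))\<^sup>2 \<partial>\<mu>)" for f n
  proof -
    let ?A = "{\<alpha> :: 'd \<Rightarrow> nat. mdeg \<alpha> = n}"
    let ?p = "\<lambda>\<alpha>. if \<alpha> \<in> ?A then f \<alpha> else 0"
    let ?q = "\<lambda>f. \<integral>z. (cmod (slice f z n))\<^sup>2 \<partial>\<mu>"
    have p: "?p \<in> H2 w"
      unfolding finite_support_expansion[OF finite_mdeg] by (intro H2_sum single_in_H2 finite_mdeg)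
    have sp: "slice ?p z n = slice f z n" for z unfolding slice_eq by (intro sum.cong) auto
    have "slice (\<Gamma> ?p) z n = h0 * slice f (u *v z) n" for z
    proof -
      have "slice (\<Gamma> ?p) z n = (\<Sum>\<alpha>\<in>?A. f \<alpha> * slice (\<Gamma> (single \<alpha>)) z n)"
        unfolding finite_support_expansion[OF finite_mdeg] bounded_operator_sum[OF \<Gamma> finite_mdeg single_in_H2] slice_sum ..
      also have "\<dots> = (\<Sum>\<alpha>\<in>?A. h0 * (f \<alpha> * zpow (u *v z) \<alpha>))"
        by (intro sum.cong refl) (auto simp: intertwiner_on_monomials[OF inter] slice_0 h0_def)
      finally show ?thesis by (simp add: slice_eq sum_distrib_left)
    qed
    then have q\<Gamma>: "?q (\<Gamma> ?p) = (cmod h0)\<^sup>2 * (\<integral>z. (cmod (slice f (u *v z) n))\<^sup>2 \<partial>\<mu>)"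
      by (simp add: norm_mult power_mult_distrib)
    have "ennreal ((\<gamma> n)\<^sup>2 * ?q (\<Gamma> ?p)) \<le> H2_sq w (\<Gamma> ?p)"
      by (rule H2_sq_degree_ge[OF \<mu> w])
    also have "\<dots> = ennreal ((H2_norm w (\<Gamma> ?p))\<^sup>2)"
      by (rule H2_sq_eq[OF bounded_operatorD(1)[OF \<Gamma> p]])
    also have "\<dots> \<le> ennreal ((C * H2_norm w ?p)\<^sup>2)"
      by (intro ennreal_leI power_mono C(2) p) simp
    finally have "(\<gamma> n)\<^sup>2 * ?q (\<Gamma> ?p) \<le> C\<^sup>2 * (H2_norm w ?p)\<^sup>2"
      by (subst (asm) ennreal_le_iff) (auto simp: power_mult_distrib)
    moreover have "ennreal ((H2_norm w ?p)\<^sup>2) = ennreal ((\<gamma> n)\<^sup>2 * ?q ?p)"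
      unfolding H2_sq_eq[OF p, symmetric] by (rule H2_sq_homogeneous[OF \<mu> w]) auto
    then have "(H2_norm w ?p)\<^sup>2 = (\<gamma> n)\<^sup>2 * ?q f" unfolding sp by (subst (asm) ennreal_inj) auto
    ultimately have "(\<gamma> n)\<^sup>2 * ?q (\<Gamma> ?p) \<le> (\<gamma> n)\<^sup>2 * (C\<^sup>2 * ?q f)" by (simp only: mult.left_commute)
    then have "?q (\<Gamma> ?p) \<le> C\<^sup>2 * ?q f" using pos(2)[of n] by (simp add: mult_le_cancel_left)
    then show ?thesis unfolding q\<Gamma> using h0 by (simp add: field_simps power_divide)
  qed
  then show ?thesis by blast
qed

text \<open>The uniform estimate bounds the integrals of all translates of \<open>|z\<^sup>\<alpha>|\<^sup>2\<close> from above, and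
from below when it is applied to \<open>(vz)\<^sup>\<alpha>\<close> and the inverse of \<open>v\<close>. Averaging replaces the
translates by the mean over the sphere.\<close>

lemma moments_comparable:
  fixes \<mu> :: "(complex^'d) measure"
  assumes \<mu>: "reinhardt_sphere_measure \<mu>"
    and bound: "\<And>u. unitary_matrix u \<Longrightarrow>
      \<exists>C. \<forall>f n. (\<integral>z. (cmod (slice f (u *v z) n))\<^sup>2 \<partial>\<mu>) \<le> C * (\<integral>z. (cmod (slice f z n))\<^sup>2 \<partial>\<mu>)"
  obtains C where "C > 0"
    "\<And>\<alpha>. moment \<mu> \<alpha> \<le> C * (measure \<mu> UNIV * moment normalized_surface_measure \<alpha>)"
    "\<And>\<alpha>. measure \<mu> UNIV * moment normalized_surface_measure \<alpha> \<le> C * moment \<mu> \<alpha>"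
proof -
  obtain C where C: "C > 0" "\<And>u f n. unitary_matrix u \<Longrightarrow>
     (\<integral>z. (cmod (slice f (u *v z) n))\<^sup>2 \<partial>\<mu>) \<le> C * (\<integral>z. (cmod (slice f z n))\<^sup>2 \<partial>\<mu>)"
    using uniform_composition_bound[OF \<mu> bound] by blast
  have b: "moment \<mu> \<alpha> / C \<le> (\<integral>z. (cmod (zpow (v *v z) \<alpha>))\<^sup>2 \<partial>\<mu>) \<and>
      (\<integral>z. (cmod (zpow (v *v z) \<alpha>))\<^sup>2 \<partial>\<mu>) \<le> C * moment \<mu> \<alpha>" if v: "unitary_matrix v" for v \<alpha>
  proof
    show "(\<integral>z. (cmod (zpow (v *v z) \<alpha>))\<^sup>2 \<partial>\<mu>) \<le> C * moment \<mu> \<alpha>"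
      using C(2)[OF v, of "single \<alpha>" "mdeg \<alpha>"] by (simp add: slice_single moment_def)
    obtain g where g: "\<And>z n. slice g z n = slice (single \<alpha>) (v *v z) n"
      using ex_slice_matrix[of "single \<alpha>" v] by blast
    have "moment \<mu> \<alpha> \<le> C * (\<integral>z. (cmod (zpow (v *v z) \<alpha>))\<^sup>2 \<partial>\<mu>)"
      using C(2)[OF unitary_matrix_adjoint[OF v], of g "mdeg \<alpha>"]
      by (simp add: g slice_single moment_def unitary_cancel[OF v])
    then show "moment \<mu> \<alpha> / C \<le> (\<integral>z. (cmod (zpow (v *v z) \<alpha>))\<^sup>2 \<partial>\<mu>)"
      using C(1) by (simp add: divide_le_eq mult.commute)
  qed
  have cont: "continuous_on UNIV (\<lambda>z :: complex^'d. (cmod (zpow z \<alpha>))\<^sup>2)" for \<alpha>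
    by (intro continuous_intros)
  show thesis
  proof (rule that[OF C(1)])
    fix \<alpha>
    note sb = surface_mean_between[OF cont \<mu> b, of \<alpha>, folded moment_def]
    show "moment \<mu> \<alpha> \<le> C * (measure \<mu> UNIV * moment normalized_surface_measure \<alpha>)"
      using sb(1) C(1) by (simp add: divide_le_eq mult.commute)
    show "measure \<mu> UNIV * moment normalized_surface_measure \<alpha> \<le> C * moment \<mu> \<alpha>"
      by (rule sb(2))
  qed
qed

text \<open>Weak homogeneity is a similarity invariant: conjugate \<open>\<Gamma>(u)\<close> by the similarity.\<close>

lemma weakly_homogeneous_similar:
  assumes T: "weakly_homogeneous v T" and sim: "similar_tuples w T' v T" and comm: "commuting_tuple w T'"
  shows "weakly_homogeneous w T'"
proof -
  obtain S R where S: "bounded_operator w v S" and R: "bounded_operator v w R"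
    and RS: "\<And>f. f \<in> H2 w \<Longrightarrow> R (S f) = f" and SR: "\<And>g. g \<in> H2 v \<Longrightarrow> S (R g) = g"
    and ST: "\<And>j f. f \<in> H2 w \<Longrightarrow> S (T' j f) = T j (S f)"
    using sim unfolding similar_tuples_def bounded_invertible_operator_def by blast
  have bT: "bounded_operator v v (T j)" and bT': "bounded_operator w w (T' j)" for j
    using sim unfolding similar_tuples_def bounded_tuple_def by auto
  note SH = bounded_operatorD(1)[OF S] and RH = bounded_operatorD(1)[OF R]
  have RT: "R (T j g) = T' j (R g)" if g: "g \<in> H2 v" for j g
    using ST[OF RH[OF g]] RS[OF bounded_operatorD(1)[OF bT' RH[OF g]]] by (simp add: SR[OF g])
  have "\<exists>\<Gamma>. bounded_invertible_operator w w \<Gamma> \<and>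
      (\<forall>j. \<forall>f\<in>H2 w. \<Gamma> (T' j f) = unitary_action u T' j (\<Gamma> f))" if u: "unitary_matrix u" for u
  proof -
    obtain \<Gamma> \<Delta> where \<Gamma>: "bounded_operator v v \<Gamma>" and \<Delta>: "bounded_operator v v \<Delta>"
      and \<Delta>\<Gamma>: "\<And>f. f \<in> H2 v \<Longrightarrow> \<Delta> (\<Gamma> f) = f" and \<Gamma>\<Delta>: "\<And>g. g \<in> H2 v \<Longrightarrow> \<Gamma> (\<Delta> g) = g"
      and \<Gamma>T: "\<And>j f. f \<in> H2 v \<Longrightarrow> \<Gamma> (T j f) = unitary_action u T j (\<Gamma> f)"
      using T u unfolding weakly_homogeneous_def bounded_invertible_operator_def by meson
    note \<Gamma>H = bounded_operatorD(1)[OF \<Gamma>] and \<Delta>H = bounded_operatorD(1)[OF \<Delta>]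
    show ?thesis
    proof (intro exI[of _ "\<lambda>f. R (\<Gamma> (S f))"] conjI allI ballI)
      show "bounded_invertible_operator w w (\<lambda>f. R (\<Gamma> (S f)))"
        unfolding bounded_invertible_operator_def
      proof (intro conjI exI[of _ "\<lambda>f. R (\<Delta> (S f))"] ballI)
        show "bounded_operator w w (\<lambda>f. R (\<Gamma> (S f)))"
          by (rule bounded_operator_compose[OF bounded_operator_compose[OF S \<Gamma>] R])
        show "bounded_operator w w (\<lambda>f. R (\<Delta> (S f)))"
          by (rule bounded_operator_compose[OF bounded_operator_compose[OF S \<Delta>] R])
      qed (simp_all add: SR \<Gamma>H \<Delta>H SH \<Delta>\<Gamma> \<Gamma>\<Delta> RS)
      fix j f assume f: "f \<in> H2 w"
      have g: "\<Gamma> (S f) \<in> H2 v" by (intro \<Gamma>H SH f)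
      have "R (\<Gamma> (S (T' j f))) = R (\<lambda>i. \<Sum>k\<in>UNIV. u $ j $ k * T k (\<Gamma> (S f)) i)"
        using f by (simp add: ST \<Gamma>T SH unitary_action_def)
      also have "\<dots> = (\<lambda>i. \<Sum>k\<in>UNIV. u $ j $ k * R (T k (\<Gamma> (S f))) i)"
        by (rule bounded_operator_sum[OF R]) (auto intro: bounded_operatorD(1)[OF bT] g)
      also have "\<dots> = unitary_action u T' j (R (\<Gamma> (S f)))"
        by (simp add: RT g unitary_action_def)
      finally show "R (\<Gamma> (S (T' j f))) = unitary_action u T' j (R (\<Gamma> (S f)))" .
    qed
  qed
  then show ?thesis using sim comm unfolding weakly_homogeneous_def similar_tuples_def by blast
qed

section \<open>Weak homogeneity of the multiplication tuple\<close>

lemma Mz_commute: "Mz j (Mz k f) = Mz k (Mz j f)"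
  by (cases "j = k") (auto simp: Mz_def fun_eq_iff fun_upd_twist)

lemma commuting_Mz: "commuting_tuple w Mz"
  by (simp add: commuting_tuple_def Mz_commute[of _ _ _])

lemma surface_space_weakly_homogeneous:
  fixes w :: "('d::finite \<Rightarrow> nat) \<Rightarrow> real"
  assumes pos: "\<And>\<alpha>. w \<alpha> > 0" and bd: "bounded_tuple w Mz"
    and rep: "has_slice_representation w (normalized_surface_measure :: (complex^'d) measure) \<gamma>"
  shows "weakly_homogeneous w Mz"
proof -
  have w: "(w \<alpha>)\<^sup>2 = (\<gamma> (mdeg \<alpha>))\<^sup>2 * moment (normalized_surface_measure :: (complex^'d) measure) \<alpha>" for \<alpha>
    using rep by (simp add: has_slice_representation_iff)
  have mpos: "moment (normalized_surface_measure :: (complex^'d) measure) \<alpha> > 0" for \<alpha>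
    using w[of \<alpha>] pos[of \<alpha>] moment_nonneg[of "normalized_surface_measure :: (complex^'d) measure" \<alpha>]
    by (metis less_eq_real_def mult_zero_right zero_less_power less_irrefl)
  show ?thesis
    unfolding weakly_homogeneous_def
    using bd commuting_Mz compose_matrix_bounded_invertible[OF _ w mpos]
      compose_matrix_intertwines[OF reinhardt_surface_measure mpos] by blast
qed

theorem theorem4p3:
  fixes \<beta> :: "('d::finite \<Rightarrow> nat) \<Rightarrow> real"
    and \<gamma> :: "nat \<Rightarrow> real"
    and \<mu> :: "(complex^'d) measure"
  assumes "\<forall>\<alpha>. \<beta> \<alpha> > 0"
    and "\<forall>n. \<gamma> n > 0"
    and "bounded_tuple \<beta> Mz"
    and "spherically_balanced \<beta>"
    and "has_slice_representation \<beta> \<mu> \<gamma>"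
  shows "weakly_homogeneous \<beta> Mz \<longleftrightarrow>
    (\<exists>\<beta>t :: ('d \<Rightarrow> nat) \<Rightarrow> real.
       (\<forall>\<alpha>. \<beta>t \<alpha> > 0) \<and>
       has_slice_representation \<beta>t normalized_surface_measure \<gamma> \<and>
       similar_tuples \<beta> Mz \<beta>t Mz)"
proof
  let ?\<sigma> = "normalized_surface_measure :: (complex^'d) measure"
  have pos: "\<beta> \<alpha> > 0" "\<gamma> n > 0" for \<alpha> n using assms(1,2) by auto
  have \<mu>: "reinhardt_sphere_measure \<mu>" and \<beta>: "(\<beta> \<alpha>)\<^sup>2 = (\<gamma> (mdeg \<alpha>))\<^sup>2 * moment \<mu> \<alpha>" for \<alpha>
    using assms(5) by (auto simp: has_slice_representation_iff)
  assume wh: "weakly_homogeneous \<beta> Mz"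
  have "\<exists>C. \<forall>f n. (\<integral>z. (cmod (slice f (u *v z) n))\<^sup>2 \<partial>\<mu>) \<le> C * (\<integral>z. (cmod (slice f z n))\<^sup>2 \<partial>\<mu>)"
    if u: "unitary_matrix u" for u
  proof -
    obtain \<Gamma> where "bounded_invertible_operator \<beta> \<beta> \<Gamma>"
      "\<And>j f. f \<in> H2 \<beta> \<Longrightarrow> \<Gamma> (Mz j f) = unitary_action u Mz j (\<Gamma> f)"
      using wh u unfolding weakly_homogeneous_def by blast
    then show ?thesis by (rule composition_bound[OF \<mu> \<beta> pos])
  qed
  then obtain C where C: "C > 0"
    "\<And>\<alpha>. moment \<mu> \<alpha> \<le> C * (measure \<mu> UNIV * moment ?\<sigma> \<alpha>)"
    "\<And>\<alpha>. measure \<mu> UNIV * moment ?\<sigma> \<alpha> \<le> C * moment \<mu> \<alpha>"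
    using moments_comparable[OF \<mu>] by blast
  let ?m = "measure \<mu> UNIV"
  have mpos: "moment \<mu> \<alpha> > 0" for \<alpha>
    using \<beta>[of \<alpha>] pos(1)[of \<alpha>] moment_nonneg[of \<mu> \<alpha>]
    by (metis less_eq_real_def mult_zero_right zero_less_power less_irrefl)
  have ms: "?m * moment ?\<sigma> \<alpha> > 0" for \<alpha>
    using C(1) C(2)[of \<alpha>] mpos[of \<alpha>] by (metis less_le_trans zero_less_mult_pos)
  have m: "?m > 0" using ms[of "\<lambda>_. 0"] measure_nonneg[of \<mu> UNIV] by (metis less_eq_real_def mult_zero_left less_irrefl)
  have spos: "moment ?\<sigma> \<alpha> > 0" for \<alpha> using ms[of \<alpha>] m by (rule zero_less_mult_pos)
  define \<beta>t where "\<beta>t = (\<lambda>\<alpha>. \<gamma> (mdeg \<alpha>) * sqrt (moment ?\<sigma> \<alpha>))"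
  have \<beta>t: "(\<beta>t \<alpha>)\<^sup>2 = (\<gamma> (mdeg \<alpha>))\<^sup>2 * moment ?\<sigma> \<alpha>" for \<alpha>
    by (simp add: \<beta>t_def power_mult_distrib)
  \<comment> \<open>Comparable moments give comparable weights in each degree, so the identity map is the similarity.\<close>
  have "(\<beta> \<alpha>)\<^sup>2 \<le> (C * ?m) * (\<beta>t \<alpha>)\<^sup>2" for \<alpha>
    unfolding \<beta> \<beta>t using mult_left_mono[OF C(2)[of \<alpha>], of "(\<gamma> (mdeg \<alpha>))\<^sup>2"] by (simp add: mult_ac)
  then have id1: "bounded_operator \<beta>t \<beta> (\<lambda>f. f)"
    by (rule bounded_operator_id[rotated]) (use C(1) m in simp)
  have "(\<beta>t \<alpha>)\<^sup>2 \<le> (C / ?m) * (\<beta> \<alpha>)\<^sup>2" for \<alpha>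
    unfolding \<beta> \<beta>t using mult_left_mono[OF C(3)[of \<alpha>], of "(\<gamma> (mdeg \<alpha>))\<^sup>2"] m by (simp add: field_simps)
  then have id2: "bounded_operator \<beta> \<beta>t (\<lambda>f. f)"
    by (rule bounded_operator_id[rotated]) (use C(1) m in simp)
  have "bounded_tuple \<beta>t Mz"
    using assms(3) bounded_operator_compose[OF bounded_operator_compose[OF id1] id2]
    unfolding bounded_tuple_def by blast
  then have "similar_tuples \<beta> Mz \<beta>t Mz"
    unfolding similar_tuples_def bounded_invertible_operator_def using assms(3) id1 id2
    by (intro conjI exI[of _ "\<lambda>f. f"]) auto
  moreover have "has_slice_representation \<beta>t ?\<sigma> \<gamma>"
    unfolding has_slice_representation_iff using reinhardt_surface_measure \<beta>t by blast
  moreover have "\<forall>\<alpha>. \<beta>t \<alpha> > 0" using pos(2) spos by (simp add: \<beta>t_def)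
  ultimately show "\<exists>\<beta>t :: ('d \<Rightarrow> nat) \<Rightarrow> real. (\<forall>\<alpha>. \<beta>t \<alpha> > 0) \<and>
       has_slice_representation \<beta>t normalized_surface_measure \<gamma> \<and> similar_tuples \<beta> Mz \<beta>t Mz"
    by blast
next
  assume "\<exists>\<beta>t :: ('d \<Rightarrow> nat) \<Rightarrow> real. (\<forall>\<alpha>. \<beta>t \<alpha> > 0) \<and>
       has_slice_representation \<beta>t normalized_surface_measure \<gamma> \<and> similar_tuples \<beta> Mz \<beta>t Mz"
  then obtain \<beta>t :: "('d \<Rightarrow> nat) \<Rightarrow> real" where \<beta>t: "\<And>\<alpha>. \<beta>t \<alpha> > 0"
    "has_slice_representation \<beta>t normalized_surface_measure \<gamma>" "similar_tuples \<beta> Mz \<beta>t Mz" by blast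
  then have "weakly_homogeneous \<beta>t Mz"
    by (intro surface_space_weakly_homogeneous) (auto simp: similar_tuples_def)
  then show "weakly_homogeneous \<beta> Mz"
    by (rule weakly_homogeneous_similar[OF _ \<beta>t(3) commuting_Mz])
qed

end
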